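(* Let $M,A\in\mathbb{N}$ with $M\ge3$ and $1<A<M$, and let $\delta=\log A/\log M$. (i) Let $\delta\in(0,2/3)$ and $\varepsilon>0$. Then there exists $\mathbb{G}=\mathbb{G}(M,\varepsilon)\subset\mathbb{A}(M,A)$ with $$\mu\big(\mathbb{A}(M,A)\setminus\mathbb{G}\big)\le4Me^{-\frac{M^{4\varepsilon}}{64}}$$ such that for all $\mathcal{A}\in\mathbb{G}$ (and every cutoff function $\chi$), the corresponding open quantum map $B_N=B_{N,\chi}$ has a spectral gap of at least $$\frac12-\frac34\delta-\varepsilon.$$ (ii) Let $\delta\in(0,1)$. Then (for every cutoff function $\chi$) the expectation, over $\mathcal{A}\in\mathbb{A}(M,A)$ with respect to $\mu$, of the spectral gap of the corresponding open quantum maps is at least $$\max\left\{0,\frac12-\frac34\delta+o_M(1)\right\},$$ where $o_M(1)$ denotes a quantity depending only on $M$ that tends to $0$ as $M\to\infty$.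
   Context: $\mathbb{A}(M,A)=\{\mathcal{A}\subset\{0,\dots,M-1\}:\mathrm{Card}(\mathcal{A})=A\}$ is the space of alphabets of cardinality $A$, and $\mu$ is the uniform counting probability measure on it: $\mu(\Omega)=\mathrm{Card}(\Omega)/\binom{M}{A}$ for $\Omega\subset\mathbb{A}(M,A)$. For $N\in\mathbb{N}$, $l^2_N$ is the Hilbert space of functions $u:\{0,\dots,N-1\}\to\mathbb{C}$ with $\|u\|_{l^2_N}^2=\sum_{j=0}^{N-1}|u(j)|^2$, and $\mathcal{F}_N:l^2_N\to l^2_N$ is the unitary discrete Fourier transform $\mathcal{F}_Nu(j)=\frac{1}{\sqrt N}\sum_{l=0}^{N-1}e^{-2\pi i jl/N}u(l)$. Open quantum map: let $\mathcal{A}\in\mathbb{A}(M,A)$, $N=M^k$ with $k\in\mathbb{N}=\{1,2,\dots\}$, and let the cutoff function $\chi\in C_0^\infty((0,1);[0,1])$ be smooth and compactly supported in $(0,1)$ with values in $[0,1]$. Let $\chi_{N/M}$ be the operator on $l^2_{N/M}$ of multiplication by $j\mapsto\chi\big(j/(N/M)\big)$. Then $B_N=B_{N,\chi}:l^2_N\to l^2_N$ is the $N\times N$ matrix $$B_N=\mathcal{F}_N^{-1}D_N,$$ where $D_N$ is block-diagonal with $M$ diagonal blocks of size $(N/M)\times(N/M)$ indexed by $a=0,\dots,M-1$ (the $a$-th block acts on the coordinates $aN/M,\dots,(a+1)N/M-1$); the $a$-th block equals $\chi_{N/M}\mathcal{F}_{N/M}\chi_{N/M}$ if $a\in\mathcal{A}$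 and equals $0$ if $a\notin\mathcal{A}$. Spectral gap: let $\mathrm{Sp}(B_N)$ be the set of eigenvalues of $B_N$. One says that $B_N$ has a spectral gap of (at least) $\beta$ if $$\limsup_{N=M^k,\ k\to\infty}\ \max\{|\lambda|:\lambda\in\mathrm{Sp}(B_N)\}\le M^{-\beta}.$$ The spectral gap associated with $(M,\mathcal{A},\chi)$ is the supremum in $[0,\infty]$ of all $\beta\ge0$ with this property (since $\|B_N\|\le1$, $\beta=0$ always qualifies). *)

theory Defs
  imports
    "HOL-Probability.Probability"
    "Jordan_Normal_Form.Gauss_Jordan_Elimination"
    "Jordan_Normal_Form.Spectral_Radius"
begin

definition alphabets :: "nat \<Rightarrow> nat \<Rightarrow> nat set set" where
  "alphabets M A = {S. S \<subseteq> {0..<M} \<and> card S = A}"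

definition alphabet_measure :: "nat \<Rightarrow> nat \<Rightarrow> nat set measure" where
  "alphabet_measure M A = uniform_count_measure (alphabets M A)"

lemma finite_alphabets [simp]: "finite (alphabets M A)"
  by (rule finite_subset[of _ "Pow {0..<M}"]) (auto simp: alphabets_def)

lemma card_alphabets: "card (alphabets M A) = M choose A"
  using n_subsets[of "{0..<M}" A] by (simp add: alphabets_def)

lemma measure_alphabet_measure:
  assumes "\<Omega> \<subseteq> alphabets M A"
  shows "measure (alphabet_measure M A) \<Omega> = real (card \<Omega>) / real (M choose A)"
  using assms by (simp add: alphabet_measure_def measure_uniform_count_measure card_alphabets)

text \<open>
  An element of \<open>C\<^sub>0\<^sup>\<infinity>((0,1);[0,1])\<close> is represented by its extension by zero to the real line,
  which is smooth exactly because the closed support of the function lies in the open interval.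
\<close>

definition cutoff :: "(real \<Rightarrow> real) \<Rightarrow> bool" where
  "cutoff chi \<longleftrightarrow>
     (\<forall>n. (deriv ^^ n) chi differentiable_on UNIV) \<and>
     (\<forall>x. chi x \<in> {0..1}) \<and>
     closure {x. chi x \<noteq> 0} \<subseteq> {0<..<1}"

definition dft :: "nat \<Rightarrow> complex mat" where
  "dft N = Matrix.mat N N (\<lambda>(j, l).
     1 / complex_of_real (sqrt (real N)) *
     exp (- 2 * complex_of_real pi * \<i> * of_nat j * of_nat l / of_nat N))"

definition dft_inv :: "nat \<Rightarrow> complex mat" where
  "dft_inv N = the (mat_inverse (dft N))"

definition cutoff_mat :: "(real \<Rightarrow> real) \<Rightarrow> nat \<Rightarrow> complex mat" where
  "cutoff_mat chi n = mat_diag n (\<lambda>j. complex_of_real (chi (real j / real n)))"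

text \<open>
  These matrices are only meaningful when \<open>M\<close> divides \<open>N\<close>.
\<close>

definition open_map_diag :: "nat \<Rightarrow> nat set \<Rightarrow> (real \<Rightarrow> real) \<Rightarrow> nat \<Rightarrow> complex mat" where
  "open_map_diag M S chi N =
     (let n = N div M in
       diag_block_mat (map (\<lambda>a.
         if a \<in> S then cutoff_mat chi n * dft n * cutoff_mat chi n else 0\<^sub>m n n) [0..<M]))"

definition open_quantum_map :: "nat \<Rightarrow> nat set \<Rightarrow> (real \<Rightarrow> real) \<Rightarrow> nat \<Rightarrow> complex mat" where
  "open_quantum_map M S chi N = dft_inv N * open_map_diag M S chi N"

text \<open>
  The constant \<open>spectral_radius\<close> is by definition the maximum of the norms of the eigenvalues.
  The index \<open>k = 0\<close>, for which the matrix is meaningless, does not affect the limit superior.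
\<close>

definition has_spectral_gap :: "nat \<Rightarrow> nat set \<Rightarrow> (real \<Rightarrow> real) \<Rightarrow> real \<Rightarrow> bool" where
  "has_spectral_gap M S chi \<beta> \<longleftrightarrow>
     limsup (\<lambda>k. ereal (spectral_radius (open_quantum_map M S chi (M ^ k)))) \<le> ereal (real M powr (- \<beta>))"

text \<open>
  The gap can be infinite, for instance when \<open>chi\<close> vanishes identically.
\<close>

definition spectral_gap :: "nat \<Rightarrow> nat set \<Rightarrow> (real \<Rightarrow> real) \<Rightarrow> ennreal" where
  "spectral_gap M S chi = (SUP \<beta> \<in> {\<beta>. 0 \<le> \<beta> \<and> has_spectral_gap M S chi \<beta>}. ennreal \<beta>)"

text \<open>
  The discrete Fourier transform is unitary, so that the inverse above exists and is given by the
  conjugate kernel.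
\<close>

lemma dft_inv_eq:
  "dft_inv N = Matrix.mat N N (\<lambda>(j, l).
     1 / complex_of_real (sqrt (real N)) *
     exp (2 * complex_of_real pi * \<i> * of_nat j * of_nat l / of_nat N))"
  (is "_ = ?G") and
  dft_inverse: "dft N * dft_inv N = 1\<^sub>m N" "dft_inv N * dft N = 1\<^sub>m N"
proof -
  have dft_carrier: "dft N \<in> carrier_mat N N" by (simp add: dft_def)
  have G_carrier: "?G \<in> carrier_mat N N" by simp
  have prod: "dft N * ?G = 1\<^sub>m N"
  proof (rule eq_matI)
    fix i j assume ij: "i < dim_row (1\<^sub>m N :: complex mat)" "j < dim_col (1\<^sub>m N :: complex mat)"
    hence i: "i < N" and j: "j < N" by auto
    define z where "z = exp (2 * complex_of_real pi * \<i> * (of_nat j - of_nat i) / of_nat N)"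
    have sq: "complex_of_real (sqrt (real N)) * complex_of_real (sqrt (real N)) = of_nat N"
      by (metis abs_of_nat of_real_mult of_real_of_nat_eq real_sqrt_mult_self)
    have summand: "dft N $$ (i, l) * ?G $$ (l, j) = z ^ l / of_nat N" if "l < N" for l
    proof -
      have "dft N $$ (i, l) * ?G $$ (l, j) =
        (exp (- 2 * complex_of_real pi * \<i> * of_nat i * of_nat l / of_nat N) *
         exp (2 * complex_of_real pi * \<i> * of_nat l * of_nat j / of_nat N)) / of_nat N"
        using that i j by (simp add: dft_def flip: sq)
      also have "exp (- 2 * complex_of_real pi * \<i> * of_nat i * of_nat l / of_nat N) *
         exp (2 * complex_of_real pi * \<i> * of_nat l * of_nat j / of_nat N) = z ^ l"
        unfolding z_def exp_of_nat_mult[symmetric] exp_add[symmetric]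
        by (rule arg_cong[where f = exp]) (simp add: field_simps diff_divide_distrib)
      finally show ?thesis .
    qed
    have "(dft N * ?G) $$ (i, j) = (\<Sum>l = 0..<N. dft N $$ (i, l) * ?G $$ (l, j))"
      using i j by (simp add: dft_def scalar_prod_def)
    also have "\<dots> = (\<Sum>l<N. z ^ l) / of_nat N"
      using summand by (simp add: sum_divide_distrib atLeast0LessThan)
    also have "\<dots> = (if i = j then 1 else 0)"
    proof (cases "i = j")
      case True
      thus ?thesis using i by (simp add: z_def)
    next
      case False
      have "z \<noteq> 1"
      proof
        assume "z = 1"
        then obtain m :: int where
          "2 * pi * (real j - real i) / real N = real_of_int (2 * m) * pi"
          unfolding z_def exp_eq_1 by auto
        hence "(2 * pi) * (real j - real i) = (2 * pi) * (real_of_int m * real N)"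
          using i by (simp add: field_simps)
        hence "real j - real i = real_of_int m * real N"
          using pi_neq_zero by (metis mult_cancel_left mult_eq_0_iff zero_neq_numeral)
        hence "real_of_int (int j - int i) = real_of_int (m * int N)"
          by simp
        hence "int j - int i = m * int N" by (simp only: of_int_eq_iff)
        hence "int j mod int N = int i mod int N"
          by (metis add.commute diff_add_cancel mod_mult_self1)
        with i j False show False by simp
      qed
      moreover have "z ^ N = 1"
      proof -
        have "z ^ N = exp (2 * complex_of_real pi * \<i> * of_int (int j - int i))"
          unfolding z_def exp_of_nat_mult[symmetric] using i by simp
        also have "\<dots> = 1"
          using exp_integer_2pi[of "of_int (int j - int i)"] by (simp add: mult_ac)
        finally show ?thesis .
      qed
      ultimately show ?thesis using False by (simp add: geometric_sum)
    qed
    also have "\<dots> = 1\<^sub>m N $$ (i, j)" using i j by simp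
    finally show "(dft N * ?G) $$ (i, j) = 1\<^sub>m N $$ (i, j)" .
  qed (simp_all add: dft_def)
  have prod': "?G * dft N = 1\<^sub>m N"
    by (rule mat_mult_left_right_inverse[OF dft_carrier G_carrier prod])
  have "dft N \<in> Units (ring_mat TYPE(complex) N ())"
    using dft_carrier G_carrier prod prod' unfolding Units_def ring_mat_def by auto
  then obtain B where B: "mat_inverse (dft N) = Some B"
    using mat_inverse(1)[OF dft_carrier, of "()"] by (cases "mat_inverse (dft N)") blast+
  note Bs = mat_inverse(2)[OF dft_carrier B]
  have "B = B * (dft N * ?G)" unfolding prod using Bs by (metis right_mult_one_mat)
  also have "\<dots> = (B * dft N) * ?G"
    using Bs dft_carrier G_carrier by (intro assoc_mult_mat[symmetric]) auto
  also have "\<dots> = ?G" using Bs left_mult_one_mat[OF G_carrier] by simp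
  finally show eq: "dft_inv N = ?G" using B by (simp add: dft_inv_def)
  show "dft N * dft_inv N = 1\<^sub>m N" "dft_inv N * dft N = 1\<^sub>m N"
    unfolding eq by (fact prod prod')+
qed

lemma open_quantum_map_carrier:
  assumes "M dvd N"
  shows "open_quantum_map M S chi N \<in> carrier_mat N N"
proof -
  have r: "sum_list (map dim_row (map (\<lambda>a. if a \<in> S then cutoff_mat chi n * dft n * cutoff_mat chi n
    else 0\<^sub>m n n) [0..<M])) = M * n"
    and c: "sum_list (map dim_col (map (\<lambda>a. if a \<in> S then cutoff_mat chi n * dft n * cutoff_mat chi n
    else 0\<^sub>m n n) [0..<M])) = M * n" for n
    by (induction M) (auto simp: cutoff_mat_def mat_diag_def)
  show ?thesis
    using assms unfolding open_quantum_map_def open_map_diag_def Let_def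
    by (intro mult_carrier_mat[of _ N N])
      (auto simp: dft_inv_eq dim_diag_block_mat r c intro!: carrier_matI simp del: map_map)
qed

end

theory Submission
  imports Defs "HOL-Real_Asymp.Real_Asymp"
begin

text \<open>
  Let \<open>\<A>\<close> be an alphabet of size \<open>A\<close>. The argument has a deterministic and a probabilistic
  half, and the number that connects them is a bound \<open>\<kappa>\<close> on the squared norm of the submatrix
  \<open>(exp (2\<pi>ijl/M))\<close>, \<open>j, l \<in> \<A>\<close>, of the unnormalized Fourier matrix of size \<open>M\<close>.

  Deterministic half: \<open>B\<^sub>N\<close> quantizes the expanding map \<open>x \<mapsto> Mx mod 1\<close>, opened up so that only
  points whose first base-\<open>M\<close> digit lies in \<open>\<A>\<close> survive. An entry of \<open>B\<^sub>N\<close> that does not follow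
  this map is negligible, because it is an exponential sum with a smooth compactly supported
  weight and a nonzero frequency (\<open>map_kernel_decay\<close>). Consequently a normalized eigenvector for
  an eigenvalue \<open>\<mu>\<close> that is not too small has norm at least about \<open>|\<mu>|\<^sup>r\<close> on the set of points
  with \<open>r\<close> digits in \<open>\<A>\<close>. Conjugating by the Fourier transform turns \<open>B\<^sub>N\<close> into its transpose,
  and read backwards the same localization says that the Fourier transform of the eigenvector is
  negligible off this set (\<open>localized_eigenvalue_bound\<close>). For \<open>r\<close> close to \<open>k\<close> this set is a thin
  neighbourhood of the discrete Cantor set with digits in \<open>\<A>\<close>, and the norm of the Fourier
  transform between two copies of that Cantor set is at most \<open>(\<kappa>/M)\<^bsup>k/2\<^esup>\<close>, because the fast
  Fourier transform factors it digit by digit (\<open>fourier_bound_cantor\<close>). Comparing both facts gives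
  \<open>|\<mu>|\<^sup>r \<le> (\<kappa>/M)\<^bsup>k/2\<^esup>\<close> up to factors whose exponential rate in \<open>k\<close> tends to zero with the
  thickness, so that the limit superior of the spectral radii is at most \<open>(\<kappa>/M)\<^bsup>1/2\<^esup>\<close>.

  Probabilistic half: by Schur's test \<open>\<kappa> \<le> A + (A - 1) t\<close>, where \<open>t\<close> bounds the sums
  \<open>\<Sum>j\<in>\<A>. exp (2\<pi>ijd/M)\<close> over all \<open>0 < d < M\<close>. For a random alphabet such a sum adds \<open>A\<close>
  draws without replacement from a population of mean zero, so it exceeds \<open>A\<^bsup>1/2\<^esup>\<close> by a large
  factor only with a probability exponentially small in the square of that factor
  (\<open>hoeffding_without_replacement\<close>). If \<open>t\<close> is about \<open>A\<^bsup>1/2\<^esup>M\<^bsup>2\<epsilon>\<^esup>\<close>, then \<open>\<kappa>\<close> is about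
  \<open>A\<^bsup>3/2\<^esup>M\<^bsup>2\<epsilon>\<^esup>\<close> and \<open>(\<kappa>/M)\<^bsup>1/2\<^esup> = M\<^bsup>-(1/2 - 3\<delta>/4 - \<epsilon>)\<^esup>\<close>. For the expectation one lets \<open>\<epsilon>\<close> decrease
  with \<open>M\<close> so slowly that the exceptional alphabets still have measure \<open>O(1/M)\<close>.
\<close>

section \<open>Additive characters and submatrices of the Fourier matrix\<close>

definition echar :: "nat \<Rightarrow> int \<Rightarrow> complex" where
  "echar N x = cis (2 * pi * real_of_int x / real N)"

lemma norm_echar [simp]: "cmod (echar N x) = 1"
  by (simp add: echar_def)

lemma echar_0 [simp]: "echar N 0 = 1"
  by (simp add: echar_def)

lemma echar_add: "echar N (x + y) = echar N x * echar N y"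
  by (simp add: echar_def cis_mult add_divide_distrib distrib_left)

lemma cnj_echar: "cnj (echar N x) = echar N (- x)"
  by (simp add: echar_def cis_cnj)

lemma echar_diff: "echar N (x - y) = echar N x * cnj (echar N y)"
  using echar_add[of N x "- y"] by (simp add: cnj_echar)

lemma echar_cancel: "m > 0 \<Longrightarrow> echar (m * n) (int m * x) = echar n x"
  by (simp add: echar_def mult.left_commute[of _ "real m"])

lemma echar_period: "n > 0 \<Longrightarrow> echar n (int n * x) = 1"
  using cis_multiple_2pi[of "real_of_int x"] by (simp add: echar_def mult_ac)

lemma echar_power: "echar N x ^ k = echar N (int k * x)"
  by (induction k) (simp_all add: echar_add distrib_right)

lemma echar_eq_1_iff:
  assumes "n > 0"
  shows "echar n x = 1 \<longleftrightarrow> int n dvd x"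
proof
  assume "echar n x = 1"
  hence "cos (2 * pi * real_of_int x / real n) = 1"
    by (simp add: echar_def complex_eq_iff)
  then obtain m :: int where "2 * pi * real_of_int x / real n = real_of_int m * 2 * pi"
    unfolding cos_one_2pi_int by blast
  hence "(2 * pi) * real_of_int x = (2 * pi) * real_of_int (m * int n)"
    using assms by (simp add: field_simps)
  hence "real_of_int x = real_of_int (m * int n)"
    by (metis mult_cancel_left mult_eq_0_iff pi_neq_zero zero_neq_numeral)
  hence "x = m * int n" by (simp only: of_int_eq_iff)
  thus "int n dvd x" by simp
next
  assume "int n dvd x"
  thus "echar n x = 1" using echar_period[OF assms] by auto
qed

lemma echar_orthogonality:
  assumes "n > 0"
  shows "(\<Sum>j<n. echar n (int j * d)) = (if int n dvd d then of_nat n else 0)"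
proof -
  have *: "echar n (int j * d) = echar n d ^ j" for j
    by (simp add: echar_power)
  show ?thesis
  proof (cases "int n dvd d")
    case True
    thus ?thesis using echar_eq_1_iff[OF assms, of d] by (simp add: *)
  next
    case False
    hence "echar n d \<noteq> 1" using echar_eq_1_iff[OF assms] by blast
    moreover have "echar n d ^ n = 1" using echar_period[OF assms, of d] by (simp add: echar_power)
    ultimately show ?thesis using False by (simp add: * geometric_sum)
  qed
qed

text \<open>
  Expanding the square exhibits the Gram matrix of the columns. It is diagonal when all rows are
  present, which is Parseval's identity, and otherwise it is what Schur's test is applied to.
\<close>

lemma echar_gram:
  "complex_of_real (\<Sum>j\<in>J. (cmod (\<Sum>l\<in>I. echar N (int j * int l) * u l))\<^sup>2) =
   (\<Sum>l\<in>I. \<Sum>l'\<in>I. u l * cnj (u l') * (\<Sum>j\<in>J. echar N (int j * (int l - int l'))))"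
proof -
  have "complex_of_real (\<Sum>j\<in>J. (cmod (\<Sum>l\<in>I. echar N (int j * int l) * u l))\<^sup>2) =
    (\<Sum>j\<in>J. \<Sum>l\<in>I. \<Sum>l'\<in>I. echar N (int j * int l) * u l * cnj (echar N (int j * int l') * u l'))"
    unfolding of_real_sum complex_norm_square by (simp add: sum_product cnj_sum)
  also have "\<dots> = (\<Sum>j\<in>J. \<Sum>l\<in>I. \<Sum>l'\<in>I. u l * cnj (u l') * echar N (int j * (int l - int l')))"
    by (intro sum.cong refl) (simp add: right_diff_distrib echar_diff mult_ac)
  also have "\<dots> = (\<Sum>l\<in>I. \<Sum>j\<in>J. \<Sum>l'\<in>I. u l * cnj (u l') * echar N (int j * (int l - int l')))"
    by (rule sum.swap)
  also have "\<dots> = (\<Sum>l\<in>I. \<Sum>l'\<in>I. \<Sum>j\<in>J. u l * cnj (u l') * echar N (int j * (int l - int l')))"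
    by (intro sum.cong refl sum.swap)
  finally show ?thesis by (simp add: sum_distrib_left)
qed

lemma parseval:
  assumes "n > 0"
  shows "(\<Sum>j<n. (cmod (\<Sum>l<n. echar n (int j * int l) * u l))\<^sup>2) = real n * (\<Sum>l<n. (cmod (u l))\<^sup>2)"
proof -
  have "complex_of_real (\<Sum>j<n. (cmod (\<Sum>l<n. echar n (int j * int l) * u l))\<^sup>2) =
    (\<Sum>l<n. \<Sum>l'<n. u l * cnj (u l') * (if l = l' then of_nat n else 0))"
    unfolding echar_gram
  proof (intro sum.cong refl)
    fix l l' assume "l \<in> {..<n}" "l' \<in> {..<n}"
    hence "int n dvd int l - int l' \<longleftrightarrow> l = l'"
      by (auto dest: zdvd_imp_le) (metis abs_of_nat dvd_imp_le_int eq_iff_diff_eq_0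
        int_ops(2) lessThan_iff linorder_not_less mod_eq_dvd_iff mod_less of_nat_eq_iff zmod_int)
    thus "u l * cnj (u l') * (\<Sum>j<n. echar n (int j * (int l - int l'))) =
      u l * cnj (u l') * (if l = l' then of_nat n else 0)"
      by (simp add: echar_orthogonality[OF assms])
  qed
  also have "\<dots> = (\<Sum>l<n. of_nat n * complex_of_real ((cmod (u l))\<^sup>2))"
    by (intro sum.cong refl)
      (simp add: complex_norm_square if_distrib mult_ac del: of_real_power cong: if_cong)
  also have "\<dots> = complex_of_real (real n * (\<Sum>l<n. (cmod (u l))\<^sup>2))"
    by (simp add: sum_distrib_left del: of_real_power)
  finally show ?thesis by (simp only: of_real_eq_iff)
qed

lemma parseval_cnj:
  assumes "n > 0"
  shows "(\<Sum>m<n. (cmod (\<Sum>l<n. cnj (echar n (int m * int l)) * v l))\<^sup>2) = real n * (\<Sum>l<n. (cmod (v l))\<^sup>2)"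
proof -
  have "cmod (\<Sum>l<n. cnj (echar n (int m * int l)) * v l) = cmod (\<Sum>l<n. echar n (int m * int l) * cnj (v l))" for m
    by (subst (2) complex_mod_cnj[symmetric]) simp
  thus ?thesis using parseval[OF assms, of "\<lambda>l. cnj (v l)"] by simp
qed

text \<open>
  An upper bound for the squared operator norm of a submatrix of the inverse Fourier matrix without
  the factor \<open>1/\<surd>N\<close>. In this normalization such bounds multiply under the fast Fourier transform.
\<close>

definition fourier_bound :: "nat \<Rightarrow> nat set \<Rightarrow> nat set \<Rightarrow> real \<Rightarrow> bool" where
  "fourier_bound N J I \<kappa> \<longleftrightarrow>
     (\<forall>u. (\<Sum>j\<in>J. (cmod (\<Sum>l\<in>I. echar N (int j * int l) * u l))\<^sup>2) \<le> \<kappa> * (\<Sum>l\<in>I. (cmod (u l))\<^sup>2))"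

lemma fourier_bound_mono:
  "fourier_bound N J I \<kappa> \<Longrightarrow> \<kappa> \<le> \<kappa>' \<Longrightarrow> fourier_bound N J I \<kappa>'"
  unfolding fourier_bound_def by (meson mult_right_mono order_trans sum_nonneg zero_le_power2)

text \<open>
  Schur's test for the Gram matrix: the diagonal entries are \<open>card S\<close>, all others have modulus at
  most \<open>t\<close>, and a hermitian matrix is bounded by its largest absolute row sum.
\<close>

lemma fourier_bound_schur:
  assumes "finite S" "S \<noteq> {}" "t \<ge> 0"
    and t: "\<And>l l'. l \<in> S \<Longrightarrow> l' \<in> S \<Longrightarrow> l \<noteq> l' \<Longrightarrow>
      cmod (\<Sum>j\<in>S. echar M (int j * (int l - int l'))) \<le> t"
  shows "fourier_bound M S S (real (card S) + (real (card S) - 1) * t)"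
  unfolding fourier_bound_def
proof
  fix u :: "nat \<Rightarrow> complex"
  define h where "h l l' = (if l = l' then real (card S) else t)" for l l' :: nat
  have rows: "(\<Sum>l'\<in>S. h l l') = real (card S) + (real (card S) - 1) * t" if "l \<in> S" for l
  proof -
    have "(\<Sum>l'\<in>S. h l l') = h l l + (\<Sum>l'\<in>S - {l}. h l l')"
      using that assms(1) by (simp add: sum.remove)
    also have "(\<Sum>l'\<in>S - {l}. h l l') = (\<Sum>l'\<in>S - {l}. t)"
      by (intro sum.cong) (auto simp: h_def)
    also have "\<dots> = (real (card S) - 1) * t"
      using that assms(1) by (simp add: of_nat_diff card_gt_0_iff Suc_leI)
        (metis One_nat_def Suc_leI card_gt_0_iff empty_iff of_nat_1 of_nat_diff)
    finally show ?thesis by (simp add: h_def)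
  qed
  have h_sym: "h l l' = h l' l" for l l' by (simp add: h_def)
  have h0: "h l l' \<ge> 0" for l l' using assms(3) by (simp add: h_def)
  define X where "X = (\<Sum>j\<in>S. (cmod (\<Sum>l\<in>S. echar M (int j * int l) * u l))\<^sup>2)"
  have "X = cmod (complex_of_real X)" by (simp add: X_def sum_nonneg del: of_real_sum)
  also have "\<dots> \<le> (\<Sum>l\<in>S. \<Sum>l'\<in>S. cmod (u l) * cmod (u l') * h l l')"
    unfolding X_def echar_gram
  proof (intro sum_norm_le)
    fix l l' assume l: "l \<in> S" "l' \<in> S"
    have "cmod (\<Sum>j\<in>S. echar M (int j * (int l - int l'))) \<le> h l l'"
      using t[OF l] by (auto simp: h_def)
    thus "cmod (u l * cnj (u l') * (\<Sum>j\<in>S. echar M (int j * (int l - int l')))) \<le>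
        cmod (u l) * cmod (u l') * h l l'"
      by (simp add: norm_mult mult_left_mono)
  qed
  also have "\<dots> \<le> (\<Sum>l\<in>S. \<Sum>l'\<in>S. ((cmod (u l))\<^sup>2 * h l l' + (cmod (u l'))\<^sup>2 * h l l') / 2)"
  proof (intro sum_mono)
    fix l l'
    have "2 * (cmod (u l) * cmod (u l')) \<le> (cmod (u l))\<^sup>2 + (cmod (u l'))\<^sup>2"
      using sum_squares_bound[of "cmod (u l)" "cmod (u l')"] by simp
    from mult_right_mono[OF this h0[of l l']]
    show "cmod (u l) * cmod (u l') * h l l' \<le> ((cmod (u l))\<^sup>2 * h l l' + (cmod (u l'))\<^sup>2 * h l l') / 2"
      by (simp add: algebra_simps)
  qed
  also have "\<dots> = ((\<Sum>l\<in>S. \<Sum>l'\<in>S. (cmod (u l))\<^sup>2 * h l l') + (\<Sum>l\<in>S. \<Sum>l'\<in>S. (cmod (u l'))\<^sup>2 * h l l')) / 2"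
    by (simp add: sum.distrib flip: sum_divide_distrib)
  also have "(\<Sum>l\<in>S. \<Sum>l'\<in>S. (cmod (u l'))\<^sup>2 * h l l') = (\<Sum>l\<in>S. \<Sum>l'\<in>S. (cmod (u l))\<^sup>2 * h l l')"
    by (subst sum.swap) (simp add: h_sym)
  also have "(\<Sum>l\<in>S. \<Sum>l'\<in>S. (cmod (u l))\<^sup>2 * h l l') =
     (\<Sum>l\<in>S. (cmod (u l))\<^sup>2 * (real (card S) + (real (card S) - 1) * t))"
    by (intro sum.cong refl) (simp add: rows flip: sum_distrib_left)
  finally show "(\<Sum>j\<in>S. (cmod (\<Sum>l\<in>S. echar M (int j * int l) * u l))\<^sup>2)
     \<le> (real (card S) + (real (card S) - 1) * t) * (\<Sum>l\<in>S. (cmod (u l))\<^sup>2)"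
    by (simp add: X_def mult.commute flip: sum_distrib_left sum_distrib_right)
qed

lemma fourier_bound_alphabet:
  assumes S: "S \<subseteq> {..<M}" "S \<noteq> {}" and "t \<ge> 0"
    and t: "\<And>d. d \<in> {1..<M} \<Longrightarrow> cmod (\<Sum>j\<in>S. echar M (int j * int d)) \<le> t"
  shows "fourier_bound M S S (real (card S) + (real (card S) - 1) * t)"
proof (rule fourier_bound_schur)
  show "finite S" using S(1) finite_subset by blast
  fix l l' assume l: "l \<in> S" "l' \<in> S" "l \<noteq> l'"
  have less: "l < M" "l' < M" using l S(1) by auto
  show "cmod (\<Sum>j\<in>S. echar M (int j * (int l - int l'))) \<le> t"
  proof (cases "l' < l")
    case True
    hence "int l - int l' = int (l - l')" by simp
    thus ?thesis using t[of "l - l'"] less True by (simp add: less_imp_diff_less)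
  next
    case False
    have neg: "int l - int l' = - int (l' - l)" using False by simp
    have "(\<Sum>j\<in>S. echar M (int j * (int l - int l'))) = cnj (\<Sum>j\<in>S. echar M (int j * int (l' - l)))"
      unfolding cnj_sum cnj_echar neg mult_minus_right ..
    moreover have "l' - l \<in> {1..<M}" using l(3) less False by auto
    ultimately show ?thesis using t[of "l' - l"] by (simp only: complex_mod_cnj)
  qed
qed (use assms in auto)

section \<open>Uncertainty principle for discrete Cantor sets\<close>

text \<open>
  The digits come from a total function, so that the lowest and the highest digit can be split off
  equally easily; the fast Fourier transform needs both.
\<close>

definition cantor :: "nat \<Rightarrow> nat set \<Rightarrow> nat \<Rightarrow> nat set" where
  "cantor M S k = {\<Sum>i<k. d i * M ^ i | d. \<forall>i. d i \<in> S}"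

lemma cantor_0: "S \<noteq> {} \<Longrightarrow> cantor M S 0 = {0}"
  by (auto simp: cantor_def intro: exI[of _ "\<lambda>_. SOME x. x \<in> S"] some_in_eq[THEN iffD2])

lemma cantor_Suc_high: "cantor M S (Suc k) = (\<lambda>(a, c). M ^ k * a + c) ` (S \<times> cantor M S k)"
proof (intro equalityI subsetI)
  fix x assume "x \<in> cantor M S (Suc k)"
  then obtain d where "\<forall>i. d i \<in> S" "x = (\<Sum>i<Suc k. d i * M ^ i)"
    by (auto simp: cantor_def)
  thus "x \<in> (\<lambda>(a, c). M ^ k * a + c) ` (S \<times> cantor M S k)"
    by (intro image_eqI[of _ _ "(d k, \<Sum>i<k. d i * M ^ i)"]) (auto simp: cantor_def mult.commute)
next
  fix x assume "x \<in> (\<lambda>(a, c). M ^ k * a + c) ` (S \<times> cantor M S k)"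
  then obtain a d where "a \<in> S" "\<forall>i. d i \<in> S" "x = M ^ k * a + (\<Sum>i<k. d i * M ^ i)"
    by (auto simp: cantor_def)
  thus "x \<in> cantor M S (Suc k)" unfolding cantor_def
    by (intro CollectI exI[of _ "d(k := a)"]) (auto simp: mult.commute)
qed

lemma cantor_Suc_low: "cantor M S (Suc k) = (\<lambda>(c, a). M * c + a) ` (cantor M S k \<times> S)"
proof (intro equalityI subsetI)
  fix x assume "x \<in> cantor M S (Suc k)"
  then obtain d where d: "\<forall>i. d i \<in> S" "x = (\<Sum>i<Suc k. d i * M ^ i)"
    by (auto simp: cantor_def)
  have "x = M * (\<Sum>i<k. d (Suc i) * M ^ i) + d 0"
    unfolding d(2) sum.lessThan_Suc_shift by (simp add: sum_distrib_left mult_ac)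
  thus "x \<in> (\<lambda>(c, a). M * c + a) ` (cantor M S k \<times> S)" using d(1)
    by (intro image_eqI[of _ _ "(\<Sum>i<k. d (Suc i) * M ^ i, d 0)"])
      (auto simp: cantor_def intro!: exI[of _ "\<lambda>i. d (Suc i)"])
next
  fix x assume "x \<in> (\<lambda>(c, a). M * c + a) ` (cantor M S k \<times> S)"
  then obtain a d where d: "a \<in> S" "\<forall>i. d i \<in> S" "x = M * (\<Sum>i<k. d i * M ^ i) + a"
    by (auto simp: cantor_def)
  have "x = (\<Sum>i<Suc k. case_nat a d i * M ^ i)"
    unfolding d(3) sum.lessThan_Suc_shift by (simp add: sum_distrib_left mult_ac)
  thus "x \<in> cantor M S (Suc k)" using d(1,2) unfolding cantor_def
    by (intro CollectI exI[of _ "case_nat a d"]) (auto split: nat.splits)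
qed

lemma cantor_less:
  assumes "S \<subseteq> {..<M}" "S \<noteq> {}"
  shows "cantor M S k \<subseteq> {..<M ^ k}"
proof (induction k)
  case 0
  thus ?case using assms by (simp add: cantor_0)
next
  case (Suc k)
  show ?case unfolding cantor_Suc_low
  proof clarsimp
    fix c a assume "c \<in> cantor M S k" "a \<in> S"
    hence "Suc c \<le> M ^ k" "a < M" using Suc assms(1) by auto
    hence "M * c + a < M * Suc c" "M * Suc c \<le> M * M ^ k" by (auto simp del: mult_Suc_right) simp
    thus "M * c + a < M * M ^ k" by linarith
  qed
qed

text \<open>
  One step of the fast Fourier transform. Write the output index with its lowest digit \<open>b\<close> split off
  and the input index with its highest digit \<open>p\<close> split off. Then the transform of length \<open>M ^ Suc k\<close>
  is a transform of length \<open>M\<close> in \<open>p\<close>, a multiplication by phases, and a transform of length \<open>M ^ k\<close>,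
  and each stage sees only digits in \<open>S\<close>.
\<close>

lemma fourier_bound_cantor:
  assumes "M > 0" "S \<subseteq> {..<M}" "S \<noteq> {}" "\<kappa> \<ge> 0" "fourier_bound M S S \<kappa>"
  shows "fourier_bound (M ^ k) (cantor M S k) (cantor M S k) (\<kappa> ^ k)"
proof (induction k)
  case 0
  show ?case using assms(3) by (simp add: cantor_0 fourier_bound_def)
next
  case (Suc k)
  let ?C = "cantor M S k"
  let ?N = "M ^ Suc k"
  have less: "c < M ^ k" if "c \<in> ?C" for c using cantor_less[OF assms(2,3)] that by blast
  have inj_low: "inj_on (\<lambda>(c, a). M * c + a) (?C \<times> S)"
  proof (rule inj_onI, clarify)
    fix c a c' a' assume "M * c + a = M * c' + a'" "a \<in> S" "a' \<in> S"
    moreover from this have "a < M" "a' < M" using assms(2) by auto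
    ultimately show "c = c' \<and> a = a'"
      by (metis add.commute assms(1) div_mult_self2 div_less add_0 mod_less mod_mult_self2 neq0_conv)
  qed
  have inj_high: "inj_on (\<lambda>(a, c). M ^ k * a + c) (S \<times> ?C)"
  proof (rule inj_onI, clarify)
    fix c a c' a' assume *: "M ^ k * a + c = M ^ k * a' + c'" "c \<in> ?C" "c' \<in> ?C"
    have "(M ^ k * a + c) div M ^ k = (M ^ k * a' + c') div M ^ k"
      "(M ^ k * a + c) mod M ^ k = (M ^ k * a' + c') mod M ^ k" by (simp_all only: *(1))
    thus "a = a' \<and> c = c'" using less[OF *(2)] less[OF *(3)] assms(1) by simp
  qed
  show ?case unfolding fourier_bound_def
  proof
    fix u :: "nat \<Rightarrow> complex"
    define w where "w b q = echar ?N (int b * int q) * (\<Sum>p\<in>S. echar M (int b * int p) * u (M ^ k * p + q))" for b q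
    \<comment> \<open>The product of the two high parts is a multiple of the length and drops out.\<close>
    have split: "echar ?N (int (M * a + b) * int (M ^ k * p + q)) =
        echar (M ^ k) (int a * int q) * (echar ?N (int b * int q) * echar M (int b * int p))" for a b p q
    proof -
      have "int (M * a + b) * int (M ^ k * p + q) =
        int ?N * (int a * int p) + (int M * (int a * int q) + (int (M ^ k) * (int b * int p) + int b * int q))"
        by (simp add: algebra_simps)
      moreover have "echar ?N (int ?N * (int a * int p)) = 1"
        using assms(1) by (intro echar_period) simp
      moreover have "echar ?N (int M * (int a * int q)) = echar (M ^ k) (int a * int q)"
        using echar_cancel[OF assms(1), of "M ^ k"] by simp
      moreover have "echar ?N (int (M ^ k) * (int b * int p)) = echar M (int b * int p)"
        using echar_cancel[of "M ^ k" M "int b * int p"] assms(1) by (simp add: mult.commute[of _ M])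
      ultimately show ?thesis by (simp only: echar_add) (simp add: mult_ac)
    qed
    have inner: "(\<Sum>l\<in>cantor M S (Suc k). echar ?N (int (M * a + b) * int l) * u l) =
        (\<Sum>q\<in>?C. echar (M ^ k) (int a * int q) * w b q)" for a b
    proof -
      have "(\<Sum>l\<in>cantor M S (Suc k). echar ?N (int (M * a + b) * int l) * u l) =
        (\<Sum>(p, q)\<in>S \<times> ?C. echar ?N (int (M * a + b) * int (M ^ k * p + q)) * u (M ^ k * p + q))"
        unfolding cantor_Suc_high sum.reindex[OF inj_high] by (simp add: case_prod_unfold)
      also have "\<dots> = (\<Sum>p\<in>S. \<Sum>q\<in>?C. echar ?N (int (M * a + b) * int (M ^ k * p + q)) * u (M ^ k * p + q))"
        by (simp add: sum.cartesian_product)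
      also have "\<dots> = (\<Sum>q\<in>?C. \<Sum>p\<in>S. echar ?N (int (M * a + b) * int (M ^ k * p + q)) * u (M ^ k * p + q))"
        by (rule sum.swap)
      finally show ?thesis unfolding split w_def by (simp add: sum_distrib_left mult_ac)
    qed
    have "(\<Sum>j\<in>cantor M S (Suc k). (cmod (\<Sum>l\<in>cantor M S (Suc k). echar ?N (int j * int l) * u l))\<^sup>2) =
       (\<Sum>(a, b)\<in>?C \<times> S. (cmod (\<Sum>l\<in>cantor M S (Suc k). echar ?N (int (M * a + b) * int l) * u l))\<^sup>2)"
      by (subst (1) cantor_Suc_low, subst sum.reindex[OF inj_low]) (simp add: case_prod_unfold)
    also have "\<dots> = (\<Sum>a\<in>?C. \<Sum>b\<in>S. (cmod (\<Sum>q\<in>?C. echar (M ^ k) (int a * int q) * w b q))\<^sup>2)"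
      unfolding inner by (simp add: sum.cartesian_product)
    also have "\<dots> = (\<Sum>b\<in>S. \<Sum>a\<in>?C. (cmod (\<Sum>q\<in>?C. echar (M ^ k) (int a * int q) * w b q))\<^sup>2)"
      by (rule sum.swap)
    also have "\<dots> \<le> (\<Sum>b\<in>S. \<kappa> ^ k * (\<Sum>q\<in>?C. (cmod (w b q))\<^sup>2))"
      using Suc by (intro sum_mono) (simp add: fourier_bound_def)
    also have "\<dots> = \<kappa> ^ k * (\<Sum>q\<in>?C. \<Sum>b\<in>S. (cmod (\<Sum>p\<in>S. echar M (int b * int p) * u (M ^ k * p + q)))\<^sup>2)"
      by (subst sum.swap) (simp add: w_def norm_mult flip: sum_distrib_left)
    also have "\<dots> \<le> \<kappa> ^ k * (\<Sum>q\<in>?C. \<kappa> * (\<Sum>p\<in>S. (cmod (u (M ^ k * p + q)))\<^sup>2))"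
      using assms(4,5) unfolding fourier_bound_def
      by (intro mult_left_mono sum_mono) (auto simp: assms(5)[unfolded fourier_bound_def, rule_format])
    also have "\<dots> = \<kappa> ^ Suc k * (\<Sum>(p, q)\<in>S \<times> ?C. (cmod (u (M ^ k * p + q)))\<^sup>2)"
      using sum.swap[of "\<lambda>p q. (cmod (u (M ^ k * p + q)))\<^sup>2" ?C S]
      by (simp add: sum_distrib_left[symmetric] sum.cartesian_product)
    also have "(\<Sum>(p, q)\<in>S \<times> ?C. (cmod (u (M ^ k * p + q)))\<^sup>2) = (\<Sum>l\<in>cantor M S (Suc k). (cmod (u l))\<^sup>2)"
      unfolding cantor_Suc_high sum.reindex[OF inj_high] by (simp add: case_prod_unfold)
    finally show "(\<Sum>j\<in>cantor M S (Suc k). (cmod (\<Sum>l\<in>cantor M S (Suc k). echar ?N (int j * int l) * u l))\<^sup>2)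
        \<le> \<kappa> ^ Suc k * (\<Sum>l\<in>cantor M S (Suc k). (cmod (u l))\<^sup>2)" .
  qed
qed

text \<open>
  Filling up the missing low digits arbitrarily from the alphabet moves a point by less than one
  unit of the last prescribed digit.
\<close>

lemma cantor_shift:
  assumes "S \<subseteq> {..<M}" "S \<noteq> {}" "c \<in> cantor M S r"
  shows "\<exists>y\<in>cantor M S (r + m). c * M ^ m \<le> y \<and> y < (c + 1) * M ^ m"
proof (induction m)
  case 0
  thus ?case using assms by auto
next
  case (Suc m)
  then obtain y where y: "y \<in> cantor M S (r + m)" "c * M ^ m \<le> y" "y < (c + 1) * M ^ m" by blast
  obtain a where a: "a \<in> S" "a < M" using assms by blast
  have "M * y + a \<in> cantor M S (r + Suc m)" using y(1) a(1) by (auto simp: cantor_Suc_low)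
  moreover have "c * M ^ Suc m \<le> M * y + a" using y(2) by (simp add: mult.left_commute trans_le_add1)
  moreover have "M * y + a < (c + 1) * M ^ Suc m"
  proof -
    have "M * (y + 1) \<le> M * ((c + 1) * M ^ m)" using y(3) by (intro mult_left_mono) auto
    thus ?thesis using a(2) by (simp add: algebra_simps)
  qed
  ultimately show ?case by blast
qed

text \<open>
  Translating the rows or the columns only multiplies the matrix by unimodular diagonal matrices, so
  a set covered by few translates inherits the bound, with a loss that is polynomial in their number.
\<close>

lemma fourier_bound_translates:
  assumes C: "finite C" and T: "finite T" and X: "finite X" and \<kappa>: "\<kappa> \<ge> 0" "fourier_bound N C C \<kappa>"
    and cover: "\<And>j. j \<in> X \<Longrightarrow> \<exists>c\<in>C. \<exists>s\<in>T. int j = int c + s"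
  shows "fourier_bound N X X ((real (card T))\<^sup>2 * \<kappa>)"
  unfolding fourier_bound_def
proof
  fix u :: "nat \<Rightarrow> complex"
  from cover obtain c s where cs: "\<And>j. j \<in> X \<Longrightarrow> c j \<in> C" "\<And>j. j \<in> X \<Longrightarrow> s j \<in> T"
    "\<And>j. j \<in> X \<Longrightarrow> int j = int (c j) + s j" by metis
  define Y where "Y = (\<lambda>t. {j \<in> X. s j = t})"
  have finY: "finite (Y t)" for t using X by (simp add: Y_def)
  have inj: "inj_on c (Y t)" for t
  proof (rule inj_onI)
    fix i j assume "i \<in> Y t" "j \<in> Y t" "c i = c j"
    thus "i = j" using cs(3)[of i] cs(3)[of j] by (simp add: Y_def)
  qed
  have img: "c ` Y t \<subseteq> C" for t using cs(1) by (auto simp: Y_def)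
  have split: "(\<Sum>j\<in>X. f j) = (\<Sum>t\<in>T. \<Sum>j\<in>Y t. f j)" for f :: "nat \<Rightarrow> 'z::comm_monoid_add"
    unfolding Y_def using cs(2) by (intro sum.group[symmetric] X T) auto
  have swap: "(\<Sum>j\<in>Y t. (\<Sum>t'\<in>T. F j t') * b) = b * (\<Sum>t'\<in>T. \<Sum>j\<in>Y t. F j t')" for F and b :: real and t
    by (simp only: sum_distrib_right[symmetric]) (subst sum.swap, rule mult.commute)
  have block: "(\<Sum>j\<in>Y t. (cmod (\<Sum>l\<in>Y t'. echar N (int j * int l) * u l))\<^sup>2) \<le> \<kappa> * (\<Sum>l\<in>Y t'. (cmod (u l))\<^sup>2)" for t t'
  proof -
    define w where "w = (\<lambda>z. if z \<in> c ` Y t' then echar N (t * int z) * u (nat (int z + t')) else 0)"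
    have w: "w (c l) = echar N (t * int (c l)) * u l" if "l \<in> Y t'" for l
    proof -
      have "int (c l) + t' = int l" using that cs(3)[of l] by (simp add: Y_def)
      thus ?thesis using that by (simp add: w_def)
    qed
    have sum_w: "(\<Sum>z\<in>C. f z (w z)) = (\<Sum>l\<in>Y t'. f (c l) (w (c l)))" if "\<And>z. f z 0 = 0"
      for f :: "nat \<Rightarrow> complex \<Rightarrow> 'z::comm_monoid_add"
    proof -
      have "(\<Sum>z\<in>C. f z (w z)) = (\<Sum>z\<in>c ` Y t'. f z (w z))"
        using that by (intro sum.mono_neutral_right C img) (auto simp: w_def)
      thus ?thesis by (simp add: sum.reindex[OF inj])
    qed
    have modulus: "cmod (\<Sum>l\<in>Y t'. echar N (int j * int l) * u l) = cmod (\<Sum>z\<in>C. echar N (int (c j) * int z) * w z)"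
      if "j \<in> Y t" for j
    proof -
      have "(\<Sum>l\<in>Y t'. echar N (int j * int l) * u l) =
        (\<Sum>l\<in>Y t'. echar N (int j * t') * (echar N (int (c j) * int (c l)) * w (c l)))"
      proof (rule sum.cong[OF refl])
        fix l assume l: "l \<in> Y t'"
        have jl: "int j = int (c j) + t" "int l = int (c l) + t'" using that l cs(3) by (auto simp: Y_def)
        have "int j * int l = int j * t' + (int (c j) * int (c l) + t * int (c l))"
          by (simp only: jl) (simp add: algebra_simps)
        thus "echar N (int j * int l) * u l = echar N (int j * t') * (echar N (int (c j) * int (c l)) * w (c l))"
          by (simp only: w[OF l] echar_add mult.assoc)
      qed
      also have "\<dots> = echar N (int j * t') * (\<Sum>z\<in>C. echar N (int (c j) * int z) * w z)"
        using sum_w[of "\<lambda>z y. echar N (int (c j) * int z) * y"] by (simp add: sum_distrib_left)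
      finally show ?thesis by (simp add: norm_mult)
    qed
    have "(\<Sum>j\<in>Y t. (cmod (\<Sum>l\<in>Y t'. echar N (int j * int l) * u l))\<^sup>2) =
      (\<Sum>y\<in>c ` Y t. (cmod (\<Sum>z\<in>C. echar N (int y * int z) * w z))\<^sup>2)"
      by (simp add: sum.reindex[OF inj] modulus)
    also have "\<dots> \<le> (\<Sum>y\<in>C. (cmod (\<Sum>z\<in>C. echar N (int y * int z) * w z))\<^sup>2)"
      by (intro sum_mono2 C img) auto
    also have "\<dots> \<le> \<kappa> * (\<Sum>z\<in>C. (cmod (w z))\<^sup>2)"
      using \<kappa>(2) unfolding fourier_bound_def by blast
    also have "(\<Sum>z\<in>C. (cmod (w z))\<^sup>2) = (\<Sum>l\<in>Y t'. (cmod (u l))\<^sup>2)"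
      using sum_w[of "\<lambda>_ y. (cmod y)\<^sup>2"] by (simp add: w norm_mult)
    finally show ?thesis .
  qed
  have "(\<Sum>j\<in>X. (cmod (\<Sum>l\<in>X. echar N (int j * int l) * u l))\<^sup>2) =
    (\<Sum>t\<in>T. \<Sum>j\<in>Y t. (cmod (\<Sum>t'\<in>T. \<Sum>l\<in>Y t'. echar N (int j * int l) * u l))\<^sup>2)"
    by (simp only: split)
  also have "\<dots> \<le> (\<Sum>t\<in>T. \<Sum>j\<in>Y t. (\<Sum>t'\<in>T. (cmod (\<Sum>l\<in>Y t'. echar N (int j * int l) * u l))\<^sup>2) * real (card T))"
  proof (intro sum_mono)
    fix t j
    define a where "a = (\<lambda>t'. \<Sum>l\<in>Y t'. echar N (int j * int l) * u l)"
    have "(cmod (\<Sum>t'\<in>T. a t'))\<^sup>2 \<le> (\<Sum>t'\<in>T. cmod (a t'))\<^sup>2"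
      by (intro power_mono norm_sum) auto
    also have "\<dots> \<le> (\<Sum>t'\<in>T. (cmod (a t'))\<^sup>2) * real (card T)"
      by (rule sum_squared_le_sum_of_squares)
    finally show "(cmod (\<Sum>t'\<in>T. \<Sum>l\<in>Y t'. echar N (int j * int l) * u l))\<^sup>2
        \<le> (\<Sum>t'\<in>T. (cmod (\<Sum>l\<in>Y t'. echar N (int j * int l) * u l))\<^sup>2) * real (card T)"
      by (simp only: a_def)
  qed
  also have "\<dots> = real (card T) * (\<Sum>t\<in>T. \<Sum>t'\<in>T. \<Sum>j\<in>Y t. (cmod (\<Sum>l\<in>Y t'. echar N (int j * int l) * u l))\<^sup>2)"
    by (simp only: swap sum_distrib_left)
  also have "\<dots> \<le> real (card T) * (\<Sum>t\<in>T. \<Sum>t'\<in>T. \<kappa> * (\<Sum>l\<in>Y t'. (cmod (u l))\<^sup>2))"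
    by (intro mult_left_mono sum_mono block) auto
  also have "\<dots> = real (card T) * (\<Sum>t\<in>T. \<kappa> * (\<Sum>l\<in>X. (cmod (u l))\<^sup>2))"
    by (simp only: split[of "\<lambda>l. (cmod (u l))\<^sup>2"] sum_distrib_left)
  also have "\<dots> = (real (card T))\<^sup>2 * \<kappa> * (\<Sum>l\<in>X. (cmod (u l))\<^sup>2)"
    by (simp add: power2_eq_square)
  finally show "(\<Sum>j\<in>X. (cmod (\<Sum>l\<in>X. echar N (int j * int l) * u l))\<^sup>2)
      \<le> (real (card T))\<^sup>2 * \<kappa> * (\<Sum>l\<in>X. (cmod (u l))\<^sup>2)" .
qed

section \<open>Concentration for uniformly random subsets\<close>

text \<open>
  The elementary symmetric polynomial of degree \<open>k\<close> in the numbers \<open>x i\<close>.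
\<close>

definition esym :: "'a set \<Rightarrow> ('a \<Rightarrow> real) \<Rightarrow> nat \<Rightarrow> real" where
  "esym I x k = (\<Sum>S | S \<subseteq> I \<and> card S = k. \<Prod>i\<in>S. x i)"

lemma esym_0: "finite I \<Longrightarrow> esym I x 0 = 1"
proof -
  assume "finite I"
  hence "{S. S \<subseteq> I \<and> card S = 0} = {{}}" by (auto dest: finite_subset)
  thus ?thesis by (simp add: esym_def)
qed

text \<open>
  The double sum of \<open>(x i - x j) * (g i - g j)\<close> has no negative terms.
\<close>

lemma chebyshev_sum:
  fixes x g :: "'a \<Rightarrow> real"
  assumes "\<And>i j. i \<in> I \<Longrightarrow> j \<in> I \<Longrightarrow> x i \<le> x j \<Longrightarrow> g i \<le> g j"
  shows "(\<Sum>i\<in>I. x i) * (\<Sum>i\<in>I. g i) \<le> real (card I) * (\<Sum>i\<in>I. x i * g i)"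
proof -
  have "0 \<le> (\<Sum>i\<in>I. \<Sum>j\<in>I. (x i - x j) * (g i - g j))"
  proof (intro sum_nonneg)
    fix i j assume "i \<in> I" "j \<in> I"
    thus "0 \<le> (x i - x j) * (g i - g j)"
      using assms[of i j] assms[of j i] by (cases "x i \<le> x j") (auto simp: zero_le_mult_iff)
  qed
  also have "\<dots> = (\<Sum>i\<in>I. \<Sum>j\<in>I. x i * g i + x j * g j - x i * g j - g i * x j)"
    by (simp add: algebra_simps)
  also have "\<dots> = (\<Sum>i\<in>I. \<Sum>j\<in>I. x i * g i) + (\<Sum>i\<in>I. \<Sum>j\<in>I. x j * g j)
      - (\<Sum>i\<in>I. x i) * (\<Sum>i\<in>I. g i) - (\<Sum>i\<in>I. g i) * (\<Sum>i\<in>I. x i)"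
    by (simp only: sum.distrib sum_subtractf sum_product)
  also have "\<dots> = 2 * (real (card I) * (\<Sum>i\<in>I. x i * g i)) - 2 * ((\<Sum>i\<in>I. x i) * (\<Sum>i\<in>I. g i))"
    by (simp flip: sum_distrib_left)
  finally show ?thesis by simp
qed

text \<open>
  Multiplying \<open>esym I x k\<close> by \<open>\<Sum>i\<in>I. x i\<close> counts every product of \<open>k + 1\<close> distinct variables \<open>k + 1\<close>
  times and leaves over the terms with a repeated variable. These amount to \<open>\<Sum>i\<in>I. x i * g i\<close>, where
  \<open>g i\<close> collects the monomials containing \<open>x i\<close>. Since \<open>g\<close> is ordered like \<open>x\<close>, Chebyshev's sum
  inequality bounds the leftover from below by its mean value.
\<close>

lemma esym_Suc_le:
  assumes fin: "finite I" and x0: "\<And>i. i \<in> I \<Longrightarrow> x i \<ge> 0"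
  shows "real (card I) * (real (Suc k) * esym I x (Suc k)) \<le> real (card I - k) * ((\<Sum>i\<in>I. x i) * esym I x k)"
proof (cases "k \<le> card I")
  case False
  hence "{S. S \<subseteq> I \<and> card S = Suc k} = {}" by (auto dest!: card_mono[OF fin])
  hence "esym I x (Suc k) = 0" unfolding esym_def by (simp only: sum.empty)
  thus ?thesis using False by simp
next
  case True
  define P where "P = (\<lambda>k. {S. S \<subseteq> I \<and> card S = k})"
  define X where "X = (\<lambda>S. \<Prod>i\<in>S. x i)"
  have finP: "finite (P k)" for k unfolding P_def by (rule finite_subset[of _ "Pow I"]) (use fin in auto)
  have finS: "finite S" if "S \<in> P k" for S k using that fin by (auto simp: P_def intro: finite_subset)
  have X0: "X S \<ge> 0" if "S \<in> P k" for S k using that x0 by (auto simp: P_def X_def intro!: prod_nonneg)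
  define g where "g = (\<lambda>i. \<Sum>S | S \<in> P k \<and> i \<in> S. X S)"
  have e: "esym I x k = (\<Sum>S\<in>P k. X S)" for k by (simp add: esym_def P_def X_def)
  have "real (Suc k) * esym I x (Suc k) = (\<Sum>T\<in>P (Suc k). \<Sum>i\<in>T. X T)"
    by (simp add: e sum_distrib_left P_def)
  also have "\<dots> = (\<Sum>(T, i)\<in>(SIGMA T:P (Suc k). T). X T)"
    by (rule sum.Sigma) (auto simp: finP dest: finS)
  also have "\<dots> = (\<Sum>(S, i)\<in>(SIGMA S:P k. I - S). X S * x i)"
  proof (rule sum.reindex_bij_witness[where i = "\<lambda>(S, i). (insert i S, i)" and j = "\<lambda>(T, i). (T - {i}, i)"], goal_cases)
    case (1 a)
    thus ?case by (auto simp: insert_absorb)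
  next
    case (2 a)
    then obtain T i where a: "a = (T, i)" "T \<subseteq> I" "card T = Suc k" "i \<in> T" by (auto simp: P_def)
    hence "card (T - {i}) = k" by (metis card_Diff_singleton diff_Suc_1)
    thus ?case using a by (auto simp: P_def)
  next
    case (3 a)
    thus ?case by auto
  next
    case (4 a)
    then obtain S i where a: "a = (S, i)" "S \<subseteq> I" "card S = k" "i \<in> I" "i \<notin> S" by (auto simp: P_def)
    hence "card (insert i S) = Suc k" using finite_subset[OF a(2) fin] by simp
    thus ?case using a by (auto simp: P_def)
  next
    case (5 a)
    then obtain T i where a: "a = (T, i)" "T \<subseteq> I" "i \<in> T" by (auto simp: P_def)
    thus ?case using finite_subset[OF a(2) fin] by (simp add: X_def prod.remove mult.commute)
  qed
  also have "\<dots> = (\<Sum>S\<in>P k. \<Sum>i\<in>I - S. X S * x i)"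
    by (rule sum.Sigma[symmetric]) (auto simp: finP fin)
  also have "\<dots> = (\<Sum>S\<in>P k. X S * (\<Sum>i\<in>I. x i) - X S * (\<Sum>i\<in>S. x i))"
  proof (rule sum.cong[OF refl])
    fix S assume "S \<in> P k"
    hence "(\<Sum>i\<in>I - S. x i) = (\<Sum>i\<in>I. x i) - (\<Sum>i\<in>S. x i)"
      using fin by (auto simp: P_def intro: sum_diff)
    thus "(\<Sum>i\<in>I - S. X S * x i) = X S * (\<Sum>i\<in>I. x i) - X S * (\<Sum>i\<in>S. x i)"
      by (simp add: right_diff_distrib flip: sum_distrib_left)
  qed
  also have "\<dots> = (\<Sum>i\<in>I. x i) * esym I x k - (\<Sum>S\<in>P k. \<Sum>i\<in>S. X S * x i)"
    by (simp add: sum_subtractf e sum_distrib_left mult.commute)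
  also have "(\<Sum>S\<in>P k. \<Sum>i\<in>S. X S * x i) = (\<Sum>S\<in>P k. \<Sum>i | i \<in> I \<and> i \<in> S. X S * x i)"
    by (intro sum.cong) (auto simp: P_def)
  also have "\<dots> = (\<Sum>i\<in>I. \<Sum>S | S \<in> P k \<and> i \<in> S. X S * x i)"
    by (rule sum.swap_restrict[OF finP fin])
  also have "\<dots> = (\<Sum>i\<in>I. x i * g i)"
    by (simp add: g_def sum_distrib_left mult.commute)
  finally have rec: "real (Suc k) * esym I x (Suc k) = (\<Sum>i\<in>I. x i) * esym I x k - (\<Sum>i\<in>I. x i * g i)" .
  have "(\<Sum>i\<in>I. g i) = (\<Sum>S\<in>P k. \<Sum>i | i \<in> I \<and> i \<in> S. X S)"
    unfolding g_def by (rule sum.swap_restrict[OF finP fin, symmetric])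
  also have "\<dots> = (\<Sum>S\<in>P k. real k * X S)"
  proof (rule sum.cong[OF refl])
    fix S assume "S \<in> P k"
    hence "{i. i \<in> I \<and> i \<in> S} = S" "card S = k" by (auto simp: P_def)
    thus "(\<Sum>i | i \<in> I \<and> i \<in> S. X S) = real k * X S" by simp
  qed
  finally have sum_g: "(\<Sum>i\<in>I. g i) = real k * esym I x k" by (simp add: e sum_distrib_left)
  \<comment> \<open>Exchanging \<open>i\<close> for \<open>j\<close> maps the monomials with only \<open>x i\<close> to those with only \<open>x j\<close>.\<close>
  have mono: "g i \<le> g j" if ij: "i \<in> I" "j \<in> I" "x i \<le> x j" for i j
  proof (cases "i = j")
    case False
    have split: "g i = (\<Sum>S | S \<in> P k \<and> i \<in> S \<and> j \<in> S. X S) + (\<Sum>S | S \<in> P k \<and> i \<in> S \<and> j \<notin> S. X S)" for i j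
    proof -
      have "{S. S \<in> P k \<and> i \<in> S} = {S. S \<in> P k \<and> i \<in> S \<and> j \<in> S} \<union> {S. S \<in> P k \<and> i \<in> S \<and> j \<notin> S}" by auto
      thus ?thesis unfolding g_def
        by (simp, intro sum.union_disjoint) (auto intro: finite_subset[OF _ finP[of k]])
    qed
    have "(\<Sum>S | S \<in> P k \<and> i \<in> S \<and> j \<notin> S. X S) \<le> (\<Sum>S | S \<in> P k \<and> i \<in> S \<and> j \<notin> S. X (insert j (S - {i})))"
    proof (rule sum_mono)
      fix S assume S: "S \<in> {S. S \<in> P k \<and> i \<in> S \<and> j \<notin> S}"
      hence "finite S" using finS by auto
      hence "X S = x i * X (S - {i})" "X (insert j (S - {i})) = x j * X (S - {i})"
        using S by (simp_all add: X_def prod.remove)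
      moreover have "X (S - {i}) \<ge> 0" using S x0 by (auto simp: P_def X_def intro!: prod_nonneg)
      ultimately show "X S \<le> X (insert j (S - {i}))" using ij(3) by (simp add: mult_right_mono)
    qed
    also have "\<dots> = (\<Sum>S | S \<in> P k \<and> j \<in> S \<and> i \<notin> S. X S)"
    proof (rule sum.reindex_bij_witness[where j = "\<lambda>S. insert j (S - {i})" and i = "\<lambda>S. insert i (S - {j})"], goal_cases)
      case (1 S)
      hence "i \<in> S" "j \<notin> S" by blast+
      thus ?case by blast
    next
      case (2 S)
      hence S: "S \<subseteq> I" "card S = k" "i \<in> S" "j \<notin> S" "finite S"
        using finite_subset[OF _ fin] by (auto simp: P_def)
      have "card (insert j (S - {i})) = k"
        using card_Suc_Diff1[OF S(5) S(3)] S by (subst card_insert_disjoint) auto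
      moreover have "insert j (S - {i}) \<subseteq> I" using S ij by blast
      ultimately show ?case using False by (simp add: P_def)
    next
      case (3 S)
      hence "j \<in> S" "i \<notin> S" by blast+
      thus ?case by blast
    next
      case (4 S)
      hence S: "S \<subseteq> I" "card S = k" "j \<in> S" "i \<notin> S" "finite S"
        using finite_subset[OF _ fin] by (auto simp: P_def)
      have "card (insert i (S - {j})) = k"
        using card_Suc_Diff1[OF S(5) S(3)] S by (subst card_insert_disjoint) auto
      moreover have "insert i (S - {j}) \<subseteq> I" using S ij by blast
      ultimately show ?case using False by (simp add: P_def)
    qed auto
    finally show ?thesis using split[of i j] split[of j i] by (simp add: conj_commute conj_left_commute)
  qed auto
  have "(\<Sum>i\<in>I. x i) * (real k * esym I x k) \<le> real (card I) * (\<Sum>i\<in>I. x i * g i)"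
    using chebyshev_sum[of I x g] mono sum_g by simp
  thus ?thesis unfolding rec using True by (simp add: of_nat_diff algebra_simps)
qed

text \<open>
  A form of Maclaurin's inequality. It says that for the product of the values of a
  nonnegative function, drawing without replacement has no larger expectation than drawing with
  replacement.
\<close>

lemma esym_le_power_mean:
  assumes fin: "finite I" and x0: "\<And>i. i \<in> I \<Longrightarrow> x i \<ge> 0" and "k \<le> card I" "I \<noteq> {}"
  shows "esym I x k \<le> real (card I choose k) * ((\<Sum>i\<in>I. x i) / real (card I)) ^ k"
  using assms(3)
proof (induction k)
  case 0
  thus ?case by (simp add: esym_0 fin)
next
  case (Suc k)
  define m where "m = (\<Sum>i\<in>I. x i) / real (card I)"
  have M: "real (card I) > 0" using fin assms(4) by (simp add: card_gt_0_iff)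
  have m: "(\<Sum>i\<in>I. x i) = real (card I) * m" using M by (simp add: m_def)
  have m0: "m \<ge> 0" using x0 by (simp add: m_def sum_nonneg)
  have "real (Suc k) * esym I x (Suc k) \<le> real (card I - k) * (m * esym I x k)"
    using esym_Suc_le[where x = x and k = k, OF fin x0] M unfolding m by (simp add: mult.left_commute mult.assoc)
  also have "\<dots> \<le> real (card I - k) * (m * (real (card I choose k) * m ^ k))"
    using Suc m0 unfolding m_def[symmetric] by (intro mult_left_mono) auto
  also have "\<dots> = real ((card I - k) * (card I choose k)) * m ^ Suc k" by simp
  also have "(card I - k) * (card I choose k) = Suc k * (card I choose Suc k)"
    using binomial_absorb_comp[of "card I" k] binomial_absorption[of k "card I"] by simp
  finally have "real (Suc k) * esym I x (Suc k) \<le> real (Suc k) * (real (card I choose Suc k) * m ^ Suc k)"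
    by (simp only: of_nat_mult mult.assoc)
  thus ?case unfolding m_def[symmetric] by (simp del: of_nat_Suc power_Suc)
qed

text \<open>
  Hoeffding's auxiliary inequality at the weight \<open>1/2\<close> is the statement \<open>ln (cosh t) \<le> t\<^sup>2/2\<close>.
\<close>

lemma cosh_le_exp: "cosh (t :: real) \<le> exp (t\<^sup>2 / 2)"
proof -
  have "cosh t \<le> exp (t\<^sup>2 / 2)" if "t \<ge> 0" for t :: real
  proof -
    have "- (2 * t) * (1 / 2) + ln (1 + 1 / 2 * (exp (2 * t) - 1)) \<le> (2 * t)\<^sup>2 / 8"
      using that by (intro Hoeffdings_lemma_aux) auto
    moreover have "1 + 1 / 2 * (exp (2 * t) - 1) = exp t * cosh t"
      by (simp add: cosh_field_def field_simps flip: exp_add)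
    moreover have "ln (exp t * cosh t) = t + ln (cosh t)"
      by (simp add: ln_mult)
    ultimately have "ln (cosh t) \<le> t\<^sup>2 / 2" by (simp add: power2_eq_square)
    thus ?thesis by (metis cosh_real_pos exp_le_cancel_iff exp_ln)
  qed
  from this[of "\<bar>t\<bar>"] show ?thesis by (cases "t \<ge> 0") auto
qed

text \<open>
  On \<open>[-1, 1]\<close> the convex function \<open>v \<mapsto> exp (t v)\<close> lies below its chord \<open>cosh t + v sinh t\<close>, whose slope
  contributes nothing to a centered sum.
\<close>

lemma exp_sum_centered_le:
  fixes v :: "'a \<Rightarrow> real"
  assumes "\<And>i. i \<in> I \<Longrightarrow> \<bar>v i\<bar> \<le> 1" "(\<Sum>i\<in>I. v i) = 0"
  shows "(\<Sum>i\<in>I. exp (t * v i)) \<le> real (card I) * exp (t\<^sup>2 / 2)"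
proof -
  have "(\<Sum>i\<in>I. exp (t * v i)) \<le> (\<Sum>i\<in>I. cosh t + v i * sinh t)"
  proof (rule sum_mono)
    fix i assume "i \<in> I"
    hence v: "\<bar>v i\<bar> \<le> 1" by (rule assms)
    have "convex_on UNIV (exp :: real \<Rightarrow> real)"
      using convex_on_exp[of 1] by simp
    hence "exp ((1 - (1 + v i) / 2) * (- t) + (1 + v i) / 2 * t) \<le>
      (1 - (1 + v i) / 2) * exp (- t) + (1 + v i) / 2 * exp t"
      using v convex_onD[of UNIV exp "(1 + v i) / 2" "- t" t] by auto
    moreover have "(1 - (1 + v i) / 2) * (- t) + (1 + v i) / 2 * t = t * v i"
      by (simp add: field_simps)
    ultimately show "exp (t * v i) \<le> cosh t + v i * sinh t"
      by (simp add: cosh_field_def sinh_field_def field_simps)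
  qed
  also have "\<dots> = real (card I) * cosh t"
    using assms(2) by (simp add: sum.distrib flip: sum_distrib_right)
  also have "\<dots> \<le> real (card I) * exp (t\<^sup>2 / 2)"
    by (intro mult_left_mono cosh_le_exp) auto
  finally show ?thesis .
qed

text \<open>
  The exponential moment of the sum over a random subset is an elementary symmetric polynomial in the
  numbers \<open>exp (t * v i)\<close>, so \<open>esym_le_power_mean\<close> reduces it to the exponential moment of one draw, and
  Chernoff's method applies as for independent summands.
\<close>

lemma hoeffding_without_replacement:
  fixes v :: "nat \<Rightarrow> real"
  assumes v: "\<And>i. i < M \<Longrightarrow> \<bar>v i\<bar> \<le> 1" "(\<Sum>i<M. v i) = 0" and "0 < A" "A \<le> M" "s \<ge> 0"
  shows "real (card {S \<in> alphabets M A. (\<Sum>i\<in>S. v i) \<ge> s}) \<le> real (M choose A) * exp (- (s\<^sup>2 / (2 * real A)))"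
proof -
  \<comment> \<open>The minimizer of \<open>A * t\<^sup>2 / 2 - t * s\<close>.\<close>
  define t where "t = s / real A"
  have alph: "alphabets M A = {S. S \<subseteq> {..<M} \<and> card S = A}"
    by (auto simp: alphabets_def atLeast0LessThan)
  have "real (card {S \<in> alphabets M A. (\<Sum>i\<in>S. v i) \<ge> s}) * exp (t * s) =
    (\<Sum>S | S \<in> alphabets M A \<and> (\<Sum>i\<in>S. v i) \<ge> s. exp (t * s))" by simp
  also have "\<dots> \<le> (\<Sum>S | S \<in> alphabets M A \<and> (\<Sum>i\<in>S. v i) \<ge> s. exp (t * (\<Sum>i\<in>S. v i)))"
    using assms by (intro sum_mono) (auto simp: t_def intro!: mult_left_mono divide_right_mono)
  also have "\<dots> \<le> (\<Sum>S\<in>alphabets M A. exp (t * (\<Sum>i\<in>S. v i)))"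
    by (intro sum_mono2) auto
  also have "\<dots> = esym {..<M} (\<lambda>i. exp (t * v i)) A"
    unfolding esym_def alph
    by (intro sum.cong refl) (auto simp: sum_distrib_left exp_sum dest: finite_subset)
  also have "\<dots> \<le> real (M choose A) * ((\<Sum>i<M. exp (t * v i)) / real M) ^ A"
    using esym_le_power_mean[of "{..<M}" "\<lambda>i. exp (t * v i)" A] assms by (simp add: lessThan_empty_iff)
  also have "\<dots> \<le> real (M choose A) * exp (t\<^sup>2 / 2) ^ A"
  proof (intro mult_left_mono power_mono)
    show "(\<Sum>i<M. exp (t * v i)) / real M \<le> exp (t\<^sup>2 / 2)"
      using exp_sum_centered_le[of "{..<M}" v t] v assms by (simp add: divide_le_eq mult.commute)
  qed (auto intro!: divide_nonneg_nonneg sum_nonneg)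
  also have "exp (t\<^sup>2 / 2) ^ A = exp (t * s) * exp (- (s\<^sup>2 / (2 * real A)))"
    using assms by (simp add: t_def power2_eq_square field_simps flip: exp_of_nat_mult exp_add)
  finally have "real (card {S \<in> alphabets M A. (\<Sum>i\<in>S. v i) \<ge> s}) * exp (t * s) \<le>
    (real (M choose A) * exp (- (s\<^sup>2 / (2 * real A)))) * exp (t * s)" by (simp add: mult_ac)
  thus ?thesis by simp
qed

text \<open>
  A union bound over the frequencies. A complex number of modulus larger than \<open>s\<close> has a real or
  imaginary part of absolute value at least \<open>s/2\<close>, which leaves four real tail estimates for each
  frequency; the sums over all residues vanish by orthogonality.
\<close>

lemma card_large_exponential_sum_le:
  assumes "0 < A" "A \<le> M" "s \<ge> 0"
  shows "real (card {S \<in> alphabets M A. \<exists>d\<in>{1..<M}. cmod (\<Sum>j\<in>S. echar M (int j * int d)) > s})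
    \<le> real (M choose A) * (4 * real M * exp (- (s\<^sup>2 / (8 * real A))))"
proof -
  \<comment> \<open>The four values of \<open>p\<close> encode the choice of a sign and of the real or imaginary part.\<close>
  let ?v = "\<lambda>d p j. (if p \<in> {0, 1} then 1 else -1) *
    (if p \<in> {0, 2::nat} then Re (echar M (int j * int d)) else Im (echar M (int j * int d)))"
  let ?B = "\<lambda>d p. {S \<in> alphabets M A. (\<Sum>j\<in>S. ?v d p j) \<ge> s / 2}"
  let ?e = "real (M choose A) * exp (- (s\<^sup>2 / (8 * real A)))"
  have B: "real (card (?B d p)) \<le> ?e" if "d \<in> {1..<M}" "p < 4" for d p
  proof -
    have "\<bar>?v d p j\<bar> \<le> 1" for j
      using abs_Re_le_cmod[of "echar M (int j * int d)"] abs_Im_le_cmod[of "echar M (int j * int d)"] by auto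
    moreover have "(\<Sum>j<M. ?v d p j) = 0"
    proof -
      have "\<not> int M dvd int d" using that by (auto dest: zdvd_imp_le)
      hence z: "(\<Sum>j<M. echar M (int j * int d)) = 0" using that by (simp add: echar_orthogonality)
      show ?thesis using arg_cong[OF z, of Re] arg_cong[OF z, of Im]
        by (cases "p = 2") (auto simp: sum_negf)
    qed
    ultimately have "real (card (?B d p)) \<le> real (M choose A) * exp (- ((s / 2)\<^sup>2 / (2 * real A)))"
      using assms by (intro hoeffding_without_replacement) auto
    thus ?thesis by (simp add: power_divide)
  qed
  have "{S \<in> alphabets M A. \<exists>d\<in>{1..<M}. cmod (\<Sum>j\<in>S. echar M (int j * int d)) > s} \<subseteq>
    (\<Union>d\<in>{1..<M}. \<Union>p\<in>{..<4}. ?B d p)"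
  proof clarify
    fix S d assume S: "S \<in> alphabets M A" "d \<in> {1..<M}" "cmod (\<Sum>j\<in>S. echar M (int j * int d)) > s"
    define z where "z = (\<Sum>j\<in>S. echar M (int j * int d))"
    have re: "Re z = (\<Sum>j\<in>S. Re (echar M (int j * int d)))"
      and im: "Im z = (\<Sum>j\<in>S. Im (echar M (int j * int d)))" by (simp_all add: z_def)
    have "\<bar>Re z\<bar> + \<bar>Im z\<bar> > s" using S(3) cmod_le[of z] unfolding z_def by linarith
    hence "Re z \<ge> s / 2 \<or> - Re z \<ge> s / 2 \<or> Im z \<ge> s / 2 \<or> - Im z \<ge> s / 2" by linarith
    moreover define Q where "Q p \<longleftrightarrow> S \<in> ?B d p" for p
    ultimately have Q: "Q 0 \<or> Q 2 \<or> Q 1 \<or> Q 3"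
      using S(1) by (simp add: Q_def re im sum_negf)
    have "\<exists>p<4. Q p"
    proof (rule ccontr)
      assume "\<not> (\<exists>p<4. Q p)"
      hence "\<not> Q 0" "\<not> Q 1" "\<not> Q 2" "\<not> Q 3" by simp_all
      with Q show False by blast
    qed
    then obtain p where p: "p \<in> {..<4}" "S \<in> ?B d p" unfolding Q_def by blast
    show "S \<in> (\<Union>d\<in>{1..<M}. \<Union>p\<in>{..<4}. ?B d p)"
      by (rule UN_I[OF S(2)], rule UN_I[OF p(1)], rule p(2))
  qed
  hence "card {S \<in> alphabets M A. \<exists>d\<in>{1..<M}. cmod (\<Sum>j\<in>S. echar M (int j * int d)) > s} \<le>
    card (\<Union>d\<in>{1..<M}. \<Union>p\<in>{..<4}. ?B d p)" by (intro card_mono) auto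
  also have "\<dots> \<le> (\<Sum>d\<in>{1..<M}. \<Sum>p<4. card (?B d p))"
    by (intro order.trans[OF card_UN_le] sum_mono card_UN_le) auto
  finally have "real (card {S \<in> alphabets M A. \<exists>d\<in>{1..<M}. cmod (\<Sum>j\<in>S. echar M (int j * int d)) > s})
    \<le> (\<Sum>d\<in>{1..<M}. \<Sum>p<4. real (card (?B d p)))"
    by (metis (no_types, lifting) of_nat_le_iff of_nat_sum sum.cong)
  also have "\<dots> \<le> (\<Sum>d\<in>{1..<M}. \<Sum>p<4::nat. ?e)"
    by (intro sum_mono B) auto
  also have "\<dots> = 4 * real (M - 1) * ?e" by simp
  also have "\<dots> \<le> 4 * real M * ?e" by (intro mult_right_mono) auto
  finally show ?thesis by (simp only: mult_ac)
qed

section \<open>Rapid decay of smooth exponential sums\<close>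

text \<open>
  Multiplying the sum by \<open>1 - z\<close> replaces the weight by its backward difference, without boundary
  terms since the weight vanishes at both ends. Each difference costs one step of length \<open>h\<close> and
  gains a factor \<open>h\<close> by the mean value theorem. The derivatives are passed as a family \<open>D\<close>, because this
  form is stable under taking differences.
\<close>

lemma iterated_summation_by_parts:
  fixes D :: "nat \<Rightarrow> real \<Rightarrow> real"
  assumes "\<And>i x. (D i has_real_derivative D (Suc i) x) (at x)"
    and "\<And>x. \<bar>D K x\<bar> \<le> C" and "h > 0"
    and "\<And>x. x < 0 \<Longrightarrow> D 0 x = 0" "\<And>x. x \<ge> real P * h \<Longrightarrow> D 0 x = 0" "cmod z = 1"
  shows "cmod (1 - z) ^ K * cmod (\<Sum>m<P. of_real (D 0 (real m * h)) * z ^ m) \<le> real (P + K) * (h ^ K * C)"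
  using assms(1,2,4,5)
proof (induction K arbitrary: D P C)
  case 0
  have "cmod (\<Sum>m<P. of_real (D 0 (real m * h)) * z ^ m) \<le> (\<Sum>m<P. C)"
    using 0(2) assms(6) by (intro sum_norm_le) (simp add: norm_mult norm_power)
  thus ?case by simp
next
  case (Suc K)
  define D' where "D' = (\<lambda>i x. D i x - D i (x - h))"
  have D': "(D' i has_real_derivative D' (Suc i) x) (at x)" for i x
  proof -
    have "((\<lambda>x. D i (x - h)) has_real_derivative D (Suc i) (x - h) * 1) (at x)"
      by (rule DERIV_chain2[OF Suc.prems(1)]) (auto intro!: derivative_eq_intros)
    thus ?thesis unfolding D'_def using DERIV_diff[OF Suc.prems(1)[of i x]] by simp
  qed
  have bound: "\<bar>D' K x\<bar> \<le> h * C" for x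
  proof -
    obtain y where "D K x - D K (x - h) = (x - (x - h)) * D (Suc K) y"
      using MVT2[of "x - h" x "D K" "D (Suc K)"] Suc.prems(1) assms(3) by auto
    thus ?thesis using Suc.prems(2)[of y] assms(3) by (simp add: D'_def abs_mult)
  qed
  have vanish: "D' 0 x = 0" if "x < 0 \<or> x \<ge> real (Suc P) * h" for x
  proof -
    have "D 0 x = 0 \<and> D 0 (x - h) = 0"
      using that Suc.prems(3)[of x] Suc.prems(3)[of "x - h"] Suc.prems(4)[of x] Suc.prems(4)[of "x - h"] assms(3)
      by (auto simp: algebra_simps)
    thus ?thesis by (simp add: D'_def)
  qed
  define f where "f m = complex_of_real (D 0 (real m * h))" for m
  have "(\<Sum>m<Suc P. of_real (D' 0 (real m * h)) * z ^ m) =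
    (\<Sum>m<Suc P. f m * z ^ m) - (\<Sum>m<Suc P. of_real (D 0 (real m * h - h)) * z ^ m)"
    by (simp only: D'_def f_def of_real_diff left_diff_distrib sum_subtractf)
  also have "(\<Sum>m<Suc P. f m * z ^ m) = (\<Sum>m<P. f m * z ^ m)"
    using Suc.prems(4) by (simp add: f_def)
  also have "(\<Sum>m<Suc P. of_real (D 0 (real m * h - h)) * z ^ m) = z * (\<Sum>m<P. f m * z ^ m)"
    unfolding sum.lessThan_Suc_shift using Suc.prems(3)[of "- h"] assms(3)
    by (simp add: f_def algebra_simps sum_distrib_left)
  finally have parts: "(\<Sum>m<Suc P. of_real (D' 0 (real m * h)) * z ^ m) = (1 - z) * (\<Sum>m<P. f m * z ^ m)"
    by (simp add: algebra_simps)
  have "cmod (1 - z) ^ K * cmod (\<Sum>m<Suc P. of_real (D' 0 (real m * h)) * z ^ m)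
      \<le> real (Suc P + K) * (h ^ K * (h * C))"
    by (rule Suc.IH[OF D' bound]) (use vanish in auto)
  thus ?case unfolding parts by (simp add: norm_mult f_def mult_ac)
qed

lemma cutoff_margin:
  assumes "cutoff chi"
  obtains c where "0 < c" "c < 1" "\<And>x. chi x \<noteq> 0 \<Longrightarrow> c \<le> x \<and> x \<le> 1 - c"
proof -
  define K where "K = closure {x. chi x \<noteq> 0}"
  have K: "K \<subseteq> {0<..<1}" "closed K" using assms by (simp_all add: cutoff_def K_def)
  have "bounded K" using K(1) by (rule bounded_subset[rotated]) simp
  hence "compact K" using K(2) compact_eq_bounded_closed by blast
  have mem: "x \<in> K" if "chi x \<noteq> 0" for x using that closure_subset[of "{x. chi x \<noteq> 0}"] by (auto simp: K_def)
  show ?thesis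
  proof (cases "K = {}")
    case True
    thus ?thesis using that[of "1 / 2"] mem by force
  next
    case False
    obtain a where a: "a \<in> K" "\<And>x. x \<in> K \<Longrightarrow> a \<le> x"
      using compact_attains_inf[OF \<open>compact K\<close> False] by blast
    obtain b where b: "b \<in> K" "\<And>x. x \<in> K \<Longrightarrow> x \<le> b"
      using compact_attains_sup[OF \<open>compact K\<close> False] by blast
    show ?thesis
    proof (rule that[of "min a (1 - b)"])
      show "0 < min a (1 - b)" "min a (1 - b) < 1" using subsetD[OF K(1) a(1)] subsetD[OF K(1) b(1)] by auto
      fix x assume "chi x \<noteq> 0"
      from mem[OF this] show "min a (1 - b) \<le> x \<and> x \<le> 1 - min a (1 - b)"
        using a(2)[of x] b(2)[of x] by linarith
    qed
  qed
qed

lemma cutoff_derivative: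
  assumes "cutoff chi"
  shows "((deriv ^^ i) chi has_real_derivative (deriv ^^ Suc i) chi x) (at x)"
  using assms by (auto simp: cutoff_def differentiable_on_def DERIV_deriv_iff_real_differentiable)

lemma cutoff_derivative_bounded:
  assumes "cutoff chi"
  obtains C where "C \<ge> 0" "\<And>x. \<bar>(deriv ^^ K) chi x\<bar> \<le> C"
proof -
  have zero: "(deriv ^^ K) chi x = 0" if "x \<in> - {0..1}" for x
    using that
  proof (induction K arbitrary: x)
    case 0
    obtain c where "0 < c" "\<And>x. chi x \<noteq> 0 \<Longrightarrow> c \<le> x \<and> x \<le> 1 - c"
      using cutoff_margin[OF assms] by metis
    thus ?case using 0 by force
  next
    case (Suc K)
    have "((deriv ^^ K) chi has_real_derivative 0) (at x)"
    proof (rule has_field_derivative_transform_within_open[OF _ _ Suc.prems])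
      show "((\<lambda>_. 0 :: real) has_real_derivative 0) (at x)" by simp
      show "open (- {0..1::real})" by (simp add: open_Compl)
      show "0 = (deriv ^^ K) chi y" if "y \<in> - {0..1}" for y using Suc.IH[OF that] by simp
    qed
    thus ?case using DERIV_unique[OF cutoff_derivative[OF assms]] by blast
  qed
  have "continuous_on {0..1} ((deriv ^^ K) chi)"
    using cutoff_derivative[OF assms, of K] by (meson DERIV_isCont continuous_at_imp_continuous_on)
  hence "bounded ((deriv ^^ K) chi ` {0..1})"
    by (intro compact_imp_bounded compact_continuous_image) auto
  then obtain C where "\<forall>x\<in>{0..1}. \<bar>(deriv ^^ K) chi x\<bar> \<le> C"
    by (auto simp: bounded_iff)
  hence C: "\<And>x. x \<in> {0..1} \<Longrightarrow> \<bar>(deriv ^^ K) chi x\<bar> \<le> C" by blast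
  show ?thesis
  proof (rule that[of "max C 0"])
    fix x show "\<bar>(deriv ^^ K) chi x\<bar> \<le> max C 0"
      using C[of x] zero[of x] by (cases "x \<in> {0..1}") auto
  qed simp
qed

text \<open>
  The frequencies that occur stay a fixed distance away from \<open>\<plusminus>1\<close>, so the only zero of the sine in
  reach is the one at the origin, which the function \<open>sinc\<close> removes.
\<close>

lemma sin_pi_lower_bound:
  fixes c :: real
  assumes "0 < c"
  obtains b where "b > 0" "\<And>x. \<bar>x\<bar> \<le> 1 - c \<Longrightarrow> b * \<bar>x\<bar> \<le> \<bar>sin (pi * x)\<bar>"
proof (cases "c \<le> 1")
  case True
  have "continuous_on {- (1 - c)..1 - c} (\<lambda>x. \<bar>sinc (pi * x)\<bar>)"
    by (intro continuous_intros continuous_on_compose2[OF continuous_on_sinc[of UNIV]]) auto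
  moreover have "{- (1 - c)..1 - c} \<noteq> {}" using True by simp
  ultimately obtain x0 where x0: "x0 \<in> {- (1 - c)..1 - c}"
    "\<And>x. x \<in> {- (1 - c)..1 - c} \<Longrightarrow> \<bar>sinc (pi * x0)\<bar> \<le> \<bar>sinc (pi * x)\<bar>"
    using continuous_attains_inf[OF compact_Icc] by blast
  have nz: "sinc (pi * x0) \<noteq> 0"
  proof (cases "x0 = 0")
    case False
    have "sin (pi * x0) \<noteq> 0"
    proof
      assume "sin (pi * x0) = 0"
      then obtain i :: int where "pi * x0 = of_int i * pi" by (auto simp: sin_zero_iff_int2)
      hence "x0 = of_int i" by simp
      moreover have "\<bar>x0\<bar> < 1" using x0(1) assms by auto
      ultimately show False using False by simp
    qed
    thus ?thesis using False by simp
  qed simp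
  show ?thesis
  proof (rule that[of "pi * \<bar>sinc (pi * x0)\<bar>"])
    fix x assume "\<bar>x\<bar> \<le> 1 - c"
    hence "\<bar>sinc (pi * x0)\<bar> * \<bar>pi * x\<bar> \<le> \<bar>sinc (pi * x)\<bar> * \<bar>pi * x\<bar>"
      by (intro mult_right_mono x0(2)) (use \<open>\<bar>x\<bar> \<le> 1 - c\<close> in \<open>auto simp: abs_le_iff\<close>)
    also have "\<dots> = \<bar>sin (pi * x)\<bar>" by (simp flip: abs_mult)
    finally show "pi * \<bar>sinc (pi * x0)\<bar> * \<bar>x\<bar> \<le> \<bar>sin (pi * x)\<bar>" by (simp add: abs_mult mult_ac)
  qed (use nz in simp)
next
  case False
  thus ?thesis using that[of 1] by fastforce
qed

lemma norm_one_minus_cis: "cmod (1 - cis t) = 2 * \<bar>sin (t / 2)\<bar>"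
  using dist_exp_i_1[of t] by (simp add: cis_conv_exp norm_minus_commute)

text \<open>
  Summation by parts \<open>K\<close> times at step \<open>1/n\<close>, where \<open>cmod (1 - cis (2 * pi * x))\<close> is comparable to \<open>\<bar>x\<bar>\<close>.
\<close>

lemma cutoff_sum_decay:
  assumes "cutoff chi" "0 < c"
  obtains C where "C \<ge> 0"
    "\<And>n x. 0 < n \<Longrightarrow> \<bar>x\<bar> \<le> 1 - c \<Longrightarrow>
      (real n * \<bar>x\<bar>) ^ K * cmod (\<Sum>m<n. of_real (chi (real m / real n)) * cis (2 * pi * x) ^ m) \<le> C * real n"
proof -
  obtain C where C: "C \<ge> 0" "\<And>x. \<bar>(deriv ^^ K) chi x\<bar> \<le> C"
    using cutoff_derivative_bounded[OF assms(1)] by blast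
  obtain b where b: "b > 0" "\<And>x. \<bar>x\<bar> \<le> 1 - c \<Longrightarrow> b * \<bar>x\<bar> \<le> \<bar>sin (pi * x)\<bar>"
    using sin_pi_lower_bound[OF assms(2)] by blast
  obtain c' where c': "0 < c'" "\<And>x. chi x \<noteq> 0 \<Longrightarrow> c' \<le> x \<and> x \<le> 1 - c'"
    using cutoff_margin[OF assms(1)] by metis
  show ?thesis
  proof (rule that[of "real (Suc K) * C / (2 * b) ^ K"])
    show "0 \<le> real (Suc K) * C / (2 * b) ^ K" using C b by simp
    fix n :: nat and x :: real assume n: "0 < n" and x: "\<bar>x\<bar> \<le> 1 - c"
    define z where "z = cis (2 * pi * x)"
    define s where "s = cmod (\<Sum>m<n. of_real (chi (real m / real n)) * z ^ m)"
    have "cmod (1 - z) ^ K * s \<le> real (n + K) * ((1 / real n) ^ K * C)"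
      using iterated_summation_by_parts[of "\<lambda>i. (deriv ^^ i) chi" K C "1 / real n" n z]
        cutoff_derivative[OF assms(1)] C(2) n c' by (force simp: z_def s_def)
    moreover have "(2 * b * \<bar>x\<bar>) ^ K * s \<le> cmod (1 - z) ^ K * s"
      using b(1) b(2)[OF x] by (intro mult_right_mono power_mono) (auto simp: z_def s_def norm_one_minus_cis)
    ultimately have "(2 * b * \<bar>x\<bar>) ^ K * s \<le> real (n + K) * ((1 / real n) ^ K * C)" by linarith
    hence "real n ^ K * ((2 * b * \<bar>x\<bar>) ^ K * s) \<le> real n ^ K * (real (n + K) * ((1 / real n) ^ K * C))"
      by (rule mult_left_mono) simp
    also have "\<dots> = real (n + K) * C" using n by (simp add: power_divide)
    also have "\<dots> \<le> (real (Suc K) * real n) * C"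
    proof (rule mult_right_mono[OF _ C(1)])
      have "real K * 1 \<le> real K * real n" using n by (intro mult_left_mono) auto
      thus "real (n + K) \<le> real (Suc K) * real n" by (simp add: algebra_simps)
    qed
    finally have "(2 * b) ^ K * ((real n * \<bar>x\<bar>) ^ K * s) \<le> real (Suc K) * C * real n"
      by (simp add: power_mult_distrib mult_ac)
    thus "(real n * \<bar>x\<bar>) ^ K * cmod (\<Sum>m<n. of_real (chi (real m / real n)) * cis (2 * pi * x) ^ m)
        \<le> real (Suc K) * C / (2 * b) ^ K * real n"
      using b(1) by (simp add: z_def s_def field_simps)
  qed
qed

section \<open>The open quantum map as a pair of kernels\<close>

definition inv_kernel :: "nat \<Rightarrow> nat \<Rightarrow> nat \<Rightarrow> complex" where
  "inv_kernel N j p = echar N (int j * int p) / of_real (sqrt (real N))"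

definition block_kernel :: "nat set \<Rightarrow> (real \<Rightarrow> real) \<Rightarrow> nat \<Rightarrow> nat \<Rightarrow> nat \<Rightarrow> complex" where
  "block_kernel S chi n p q = (if p div n = q div n \<and> p div n \<in> S then
     of_real (chi (real (p mod n) / real n)) *
     (cnj (echar n (int (p mod n) * int (q mod n))) / of_real (sqrt (real n))) *
     of_real (chi (real (q mod n) / real n)) else 0)"

text \<open>
  The entries of the open quantum map itself.
\<close>

definition map_kernel :: "nat set \<Rightarrow> (real \<Rightarrow> real) \<Rightarrow> nat \<Rightarrow> nat \<Rightarrow> nat \<Rightarrow> nat \<Rightarrow> complex" where
  "map_kernel S chi N n j q = (\<Sum>p<N. inv_kernel N j p * block_kernel S chi n p q)"

lemma inv_kernel_sym: "inv_kernel N j p = inv_kernel N p j"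
  by (simp add: inv_kernel_def mult.commute)

lemma block_kernel_sym: "block_kernel S chi n p q = block_kernel S chi n q p"
  by (auto simp: block_kernel_def mult_ac)

lemma sum_blocks: "(\<Sum>p<M * n. f p) = (\<Sum>a<M. \<Sum>m<n. f (a * n + m))"
  for f :: "nat \<Rightarrow> 'a :: comm_monoid_add"
  unfolding sum.nat_group[symmetric]
  by (rule sum.cong[OF refl]) (simp add: sum.atLeastLessThan_shift_0[of _ "_ * n"] atLeast0LessThan)

lemma dft_index: "m < n \<Longrightarrow> l < n \<Longrightarrow> dft n $$ (m, l) = cnj (echar n (int m * int l)) / of_real (sqrt (real n))"
  unfolding cnj_echar by (simp add: dft_def echar_def cis_conv_exp mult_ac)

lemma dft_inv_index: "j < N \<Longrightarrow> p < N \<Longrightarrow> dft_inv N $$ (j, p) = inv_kernel N j p"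
  by (simp add: dft_inv_eq inv_kernel_def echar_def cis_conv_exp mult_ac)

lemma diag_block_mat_uniform:
  fixes F :: "nat \<Rightarrow> complex mat"
  assumes "\<And>a. F a \<in> carrier_mat n n" "n > 0"
  shows "diag_block_mat (map F [0..<M]) \<in> carrier_mat (M * n) (M * n) \<and>
    (\<forall>i<M * n. \<forall>j<M * n. diag_block_mat (map F [0..<M]) $$ (i, j) =
      (if i div n = j div n then F (i div n) $$ (i mod n, j mod n) else 0))"
proof (induction M)
  case 0
  thus ?case by auto
next
  case (Suc M)
  define R where "R = diag_block_mat (map F [0..<M])"
  have R: "R \<in> carrier_mat (M * n) (M * n)"
    "\<And>i j. i < M * n \<Longrightarrow> j < M * n \<Longrightarrow> R $$ (i, j) = (if i div n = j div n then F (i div n) $$ (i mod n, j mod n) else 0)"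
    using Suc unfolding R_def by blast+
  have F: "dim_row (F M) = n" "dim_col (F M) = n" using assms(1)[of M] by auto
  have eq: "diag_block_mat (map F [0..<Suc M]) = four_block_mat R (0\<^sub>m (M * n) n) (0\<^sub>m n (M * n)) (F M)"
    using R(1) F by (simp add: diag_block_mat_last flip: R_def)
  have small: "i div n < M" if "i < M * n" for i
    using that by (simp add: less_mult_imp_div_less)
  have large: "i div n = M" "i mod n = i - M * n" if "\<not> i < M * n" "i < Suc M * n" for i
  proof -
    have "i = M * n + (i - M * n)" "i - M * n < n" using that by auto
    thus "i div n = M" "i mod n = i - M * n"
      by (metis add.commute assms(2) div_less div_mult_self1 less_not_refl2 plus_nat.add_0,
          metis mod_less mod_mult_self3)
  qed
  show ?case unfolding eq
  proof (intro conjI allI impI)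
    show "four_block_mat R (0\<^sub>m (M * n) n) (0\<^sub>m n (M * n)) (F M) \<in> carrier_mat (Suc M * n) (Suc M * n)"
      using R(1) F by (auto simp: add.commute)
    fix i j assume ij: "i < Suc M * n" "j < Suc M * n"
    show "four_block_mat R (0\<^sub>m (M * n) n) (0\<^sub>m n (M * n)) (F M) $$ (i, j) =
        (if i div n = j div n then F (i div n) $$ (i mod n, j mod n) else 0)"
    proof (cases "i < M * n")
      case i: True
      show ?thesis
      proof (cases "j < M * n")
        case True
        thus ?thesis using i ij R F by simp
      next
        case False
        hence "i div n \<noteq> j div n" using small[OF i] large[of j] ij by simp
        thus ?thesis using False i ij R F by simp
      qed
    next
      case i: False
      show ?thesis
      proof (cases "j < M * n")
        case True
        hence "i div n \<noteq> j div n" using small[OF True] large[of i] ij i by simp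
        thus ?thesis using True i ij R F by simp
      next
        case False
        thus ?thesis using i ij R F large[of i] large[of j] by simp
      qed
    qed
  qed
qed

lemma open_map_diag_index:
  assumes "n > 0" "N = M * n" "M > 0"
  shows "open_map_diag M S chi N \<in> carrier_mat N N"
    and "p < N \<Longrightarrow> q < N \<Longrightarrow> open_map_diag M S chi N $$ (p, q) = block_kernel S chi n p q"
proof -
  define F where "F = (\<lambda>a. if a \<in> S then cutoff_mat chi n * dft n * cutoff_mat chi n else 0\<^sub>m n n)"
  have dft: "dft n \<in> carrier_mat n n" by (simp add: dft_def)
  have diag: "cutoff_mat chi n \<in> carrier_mat n n" by (simp add: cutoff_mat_def)
  have F: "F a \<in> carrier_mat n n" for a
    using dft diag by (auto simp: F_def intro!: mult_carrier_mat)
  have eq: "open_map_diag M S chi N = diag_block_mat (map F [0..<M])"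
    using assms by (simp add: open_map_diag_def F_def Let_def)
  note uniform = diag_block_mat_uniform[of F n M, OF F assms(1)]
  show "open_map_diag M S chi N \<in> carrier_mat N N" using uniform assms(2) unfolding eq by blast
  assume pq: "p < N" "q < N"
  have less: "p mod n < n" "q mod n < n" using assms(1) by simp_all
  have block: "(cutoff_mat chi n * dft n * cutoff_mat chi n) $$ (m, l) =
      of_real (chi (real m / real n)) * dft n $$ (m, l) * of_real (chi (real l / real n))"
    if "m < n" "l < n" for m l
    using that dft unfolding cutoff_mat_def
    by (simp add: mat_diag_mult_left[OF dft] mat_diag_mult_right[of _ n n])
  have "diag_block_mat (map F [0..<M]) $$ (p, q) =
      (if p div n = q div n then F (p div n) $$ (p mod n, q mod n) else 0)"
    using uniform pq unfolding assms(2) by blast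
  thus "open_map_diag M S chi N $$ (p, q) = block_kernel S chi n p q"
    unfolding eq using less by (simp add: F_def block_kernel_def block dft_index)
qed

lemma mult_mat_vec_index:
  "A \<in> carrier_mat N N \<Longrightarrow> v \<in> carrier_vec N \<Longrightarrow> i < N \<Longrightarrow> (A *\<^sub>v v) $ i = (\<Sum>j<N. A $$ (i, j) * v $ j)"
  by (auto simp: scalar_prod_def atLeast0LessThan intro!: sum.cong)

abbreviation l2norm :: "nat set \<Rightarrow> (nat \<Rightarrow> complex) \<Rightarrow> real" where
  "l2norm A u \<equiv> L2_set (\<lambda>i. cmod (u i)) A"

lemma l2norm_add: "l2norm A (\<lambda>i. u i + v i) \<le> l2norm A u + l2norm A v"
  by (intro order.trans[OF L2_set_mono L2_set_triangle_ineq] norm_triangle_ineq) auto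

lemma l2norm_scale: "l2norm A (\<lambda>i. c * u i) = cmod c * l2norm A u"
  by (simp add: norm_mult L2_set_right_distrib)

lemma l2norm_subset: "finite B \<Longrightarrow> A \<subseteq> B \<Longrightarrow> l2norm A u \<le> l2norm B u"
  unfolding L2_set_def by (intro real_sqrt_le_mono sum_mono2) auto

lemma l2norm_split:
  assumes "finite B" "A \<subseteq> B"
  shows "l2norm J (\<lambda>j. \<Sum>q\<in>B. k j q * v q) \<le>
    l2norm J (\<lambda>j. \<Sum>q\<in>A. k j q * v q) + l2norm J (\<lambda>j. \<Sum>q\<in>B - A. k j q * v q)"
  using l2norm_add[where A = J and u = "\<lambda>j. \<Sum>q\<in>A. k j q * v q" and v = "\<lambda>j. \<Sum>q\<in>B - A. k j q * v q"]
  by (simp add: sum.subset_diff[OF assms(2,1)] add.commute)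

text \<open>
  The vector \<open>w\<close> is the Fourier transform of the eigenvector \<open>u\<close>. In terms of the pair \<open>(u, w)\<close> the
  eigenvalue equation splits into one equation for each of the two factors of the map.
\<close>

lemma open_quantum_map_eigenpair:
  assumes n: "n > 0" "N = M * n" "M > 0" and \<mu>: "\<mu> \<in> spectrum (open_quantum_map M S chi N)"
  obtains u w where "l2norm {..<N} u = 1"
    "\<And>j. j < N \<Longrightarrow> u j = (\<Sum>p<N. inv_kernel N j p * w p)"
    "\<And>p. p < N \<Longrightarrow> \<mu> * w p = (\<Sum>q<N. block_kernel S chi n p q * u q)"
proof -
  let ?D = "open_map_diag M S chi N"
  note D = open_map_diag_index[where S = S and chi = chi, OF n]
  have dft: "dft N \<in> carrier_mat N N" by (simp add: dft_def)
  have inv: "dft_inv N \<in> carrier_mat N N" by (simp add: dft_inv_eq)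
  have B: "open_quantum_map M S chi N \<in> carrier_mat N N"
    using D(1) inv by (simp add: open_quantum_map_def)
  obtain v where v: "v \<in> carrier_vec N" "v \<noteq> 0\<^sub>v N" "open_quantum_map M S chi N *\<^sub>v v = \<mu> \<cdot>\<^sub>v v"
    using \<mu> B by (auto simp: spectrum_def eigenvalue_def eigenvector_def)
  define f where "f = dft N *\<^sub>v v"
  have f: "f \<in> carrier_vec N" using dft v(1) by (simp add: f_def)
  have "dft_inv N *\<^sub>v f = (dft_inv N * dft N) *\<^sub>v v"
    unfolding f_def using inv dft v(1) by (rule assoc_mult_mat_vec[symmetric])
  hence v_f: "dft_inv N *\<^sub>v f = v" using v(1) by (simp add: dft_inverse)
  have "?D *\<^sub>v v = (dft N * dft_inv N) *\<^sub>v (?D *\<^sub>v v)" using D(1) v(1) by (simp add: dft_inverse)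
  also have "\<dots> = dft N *\<^sub>v (dft_inv N *\<^sub>v (?D *\<^sub>v v))"
    by (rule assoc_mult_mat_vec[OF dft inv]) (use D(1) v(1) in simp)
  also have "dft_inv N *\<^sub>v (?D *\<^sub>v v) = \<mu> \<cdot>\<^sub>v v"
    using v(3) assoc_mult_mat_vec[OF inv D(1) v(1)] by (simp add: open_quantum_map_def)
  also have "dft N *\<^sub>v (\<mu> \<cdot>\<^sub>v v) = \<mu> \<cdot>\<^sub>v f"
    unfolding f_def by (rule mult_mat_vec[OF dft v(1)])
  finally have Dv: "?D *\<^sub>v v = \<mu> \<cdot>\<^sub>v f" .
  define s where "s = l2norm {..<N} (($) v)"
  have "s \<noteq> 0"
  proof
    assume "s = 0"
    hence "\<forall>i<N. v $ i = 0" by (simp add: s_def L2_set_eq_0_iff)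
    hence "v = 0\<^sub>v N" using v(1) by auto
    with v(2) show False by simp
  qed
  hence s: "s > 0" by (simp add: s_def order_less_le)
  show ?thesis
  proof (rule that[of "\<lambda>i. inverse (of_real s) * v $ i" "\<lambda>i. inverse (of_real s) * f $ i"])
    show "l2norm {..<N} (\<lambda>i. inverse (of_real s) * v $ i) = 1"
      using s by (subst l2norm_scale) (simp add: norm_inverse flip: s_def)
    fix j assume j: "j < N"
    have "v $ j = (\<Sum>p<N. inv_kernel N j p * f $ p)"
      using mult_mat_vec_index[OF inv f j] j by (simp add: v_f dft_inv_index)
    thus "inverse (of_real s) * v $ j = (\<Sum>p<N. inv_kernel N j p * (inverse (of_real s) * f $ p))"
      by (simp add: sum_distrib_left mult_ac)
    have "\<mu> * f $ j = (\<Sum>q<N. block_kernel S chi n j q * v $ q)"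
      using mult_mat_vec_index[OF D(1) v(1) j] j f by (simp add: Dv D(2))
    hence "inverse (of_real s) * (\<mu> * f $ j) = inverse (of_real s) * (\<Sum>q<N. block_kernel S chi n j q * v $ q)"
      by simp
    thus "\<mu> * (inverse (of_real s) * f $ j) = (\<Sum>q<N. block_kernel S chi n j q * (inverse (of_real s) * v $ q))"
      by (simp add: sum_distrib_left mult_ac)
  qed
qed

lemma inv_kernel_isometry:
  "l2norm {..<N} (\<lambda>j. \<Sum>p<N. inv_kernel N j p * v p) = l2norm {..<N} v"
proof (cases "N = 0")
  case False
  have "l2norm {..<N} (\<lambda>j. \<Sum>p<N. inv_kernel N j p * v p) =
    sqrt ((\<Sum>j<N. (cmod (\<Sum>p<N. echar N (int j * int p) * v p))\<^sup>2) / real N)"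
    by (simp add: L2_set_def inv_kernel_def norm_divide power_divide sum_divide_distrib flip: sum_divide_distrib)
  also have "\<dots> = l2norm {..<N} v" using False by (simp add: parseval L2_set_def)
  finally show ?thesis .
qed simp

lemma block_kernel_sum:
  assumes "m < n" "a < M"
  shows "(\<Sum>q<M * n. block_kernel S chi n (a * n + m) q * v q) =
    (\<Sum>l<n. block_kernel S chi n (a * n + m) (a * n + l) * v (a * n + l))"
proof -
  have "(\<Sum>l<n. block_kernel S chi n (a * n + m) (b * n + l) * v (b * n + l)) = 0" if "b \<noteq> a" for b
    using that assms by (intro sum.neutral) (auto simp: block_kernel_def)
  hence "(\<Sum>b<M. \<Sum>l<n. block_kernel S chi n (a * n + m) (b * n + l) * v (b * n + l)) =
    (\<Sum>b\<in>{a}. \<Sum>l<n. block_kernel S chi n (a * n + m) (b * n + l) * v (b * n + l))"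
    using assms by (intro sum.mono_neutral_right) auto
  thus ?thesis by (simp add: sum_blocks)
qed

lemma block_kernel_contraction:
  assumes n: "n > 0" and chi: "\<And>x. 0 \<le> chi x \<and> chi x \<le> 1"
  shows "l2norm {..<M * n} (\<lambda>p. \<Sum>q<M * n. block_kernel S chi n p q * v q) \<le> l2norm {..<M * n} v"
proof -
  have block: "(\<Sum>m<n. (cmod (\<Sum>l<n. block_kernel S chi n (a * n + m) (a * n + l) * v (a * n + l)))\<^sup>2)
      \<le> (\<Sum>l<n. (cmod (v (a * n + l)))\<^sup>2)" for a
  proof -
    define g where "g l = of_real (chi (real l / real n)) * v (a * n + l)" for l
    have "cmod (\<Sum>l<n. block_kernel S chi n (a * n + m) (a * n + l) * v (a * n + l)) \<le>
        cmod (\<Sum>l<n. cnj (echar n (int m * int l)) * g l) / sqrt (real n)" if "m < n" for m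
    proof (cases "a \<in> S")
      case True
      have "(\<Sum>l<n. block_kernel S chi n (a * n + m) (a * n + l) * v (a * n + l)) =
        (of_real (chi (real m / real n)) / of_real (sqrt (real n))) * (\<Sum>l<n. cnj (echar n (int m * int l)) * g l)"
        unfolding sum_distrib_left using True that
        by (intro sum.cong refl) (simp add: block_kernel_def g_def)
      hence "cmod (\<Sum>l<n. block_kernel S chi n (a * n + m) (a * n + l) * v (a * n + l)) =
        chi (real m / real n) * (cmod (\<Sum>l<n. cnj (echar n (int m * int l)) * g l) / sqrt (real n))"
        using chi by (simp add: norm_mult norm_divide)
      also have "\<dots> \<le> 1 * (cmod (\<Sum>l<n. cnj (echar n (int m * int l)) * g l) / sqrt (real n))"
        using chi by (intro mult_right_mono) auto
      finally show ?thesis by simp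
    next
      case False
      hence "(\<Sum>l<n. block_kernel S chi n (a * n + m) (a * n + l) * v (a * n + l)) = 0"
        using that by (intro sum.neutral) (simp add: block_kernel_def)
      thus ?thesis by simp
    qed
    hence "(\<Sum>m<n. (cmod (\<Sum>l<n. block_kernel S chi n (a * n + m) (a * n + l) * v (a * n + l)))\<^sup>2) \<le>
      (\<Sum>m<n. (cmod (\<Sum>l<n. cnj (echar n (int m * int l)) * g l) / sqrt (real n))\<^sup>2)"
      by (intro sum_mono power_mono) auto
    also have "\<dots> = (\<Sum>l<n. (cmod (g l))\<^sup>2)"
      using n parseval_cnj[OF n, of g] by (simp add: power_divide flip: sum_divide_distrib)
    also have "\<dots> \<le> (\<Sum>l<n. (cmod (v (a * n + l)))\<^sup>2)"
    proof (intro sum_mono power_mono)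
      fix l show "cmod (g l) \<le> cmod (v (a * n + l))"
        using chi[of "real l / real n"] mult_right_mono[of "chi (real l / real n)" 1 "cmod (v (a * n + l))"]
        by (simp add: g_def norm_mult)
    qed auto
    finally show ?thesis .
  qed
  have "(\<Sum>p<M * n. (cmod (\<Sum>q<M * n. block_kernel S chi n p q * v q))\<^sup>2) =
    (\<Sum>a<M. \<Sum>m<n. (cmod (\<Sum>l<n. block_kernel S chi n (a * n + m) (a * n + l) * v (a * n + l)))\<^sup>2)"
    by (subst sum_blocks) (simp add: block_kernel_sum)
  also have "\<dots> \<le> (\<Sum>a<M. \<Sum>l<n. (cmod (v (a * n + l)))\<^sup>2)"
    by (intro sum_mono block)
  finally show ?thesis unfolding L2_set_def by (intro real_sqrt_le_mono) (simp add: sum_blocks)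
qed

lemma kernel_compose:
  fixes f :: "nat \<Rightarrow> complex"
  shows "(\<Sum>q\<in>B. (\<Sum>p\<in>A. f p * g p q) * v q) = (\<Sum>p\<in>A. f p * (\<Sum>q\<in>B. g p q * v q))"
  unfolding sum_distrib_right sum_distrib_left by (subst sum.swap) (simp add: mult.assoc)

lemma map_kernel_apply:
  "(\<Sum>q<N. map_kernel S chi N n j q * v q) = (\<Sum>p<N. inv_kernel N j p * (\<Sum>q<N. block_kernel S chi n p q * v q))"
  unfolding map_kernel_def by (rule kernel_compose)

text \<open>
  Both factors are symmetric, so the transpose of the map is the product in the opposite order, that
  is, the map conjugated by the Fourier transform. This is why the Fourier transform of an
  eigenfunction obeys the same localization as the eigenfunction.
\<close>

lemma map_kernel_apply_transpose:
  "(\<Sum>j<N. map_kernel S chi N n j q * v j) = (\<Sum>p<N. block_kernel S chi n q p * (\<Sum>j<N. inv_kernel N p j * v j))"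
proof -
  have "map_kernel S chi N n j q = (\<Sum>p<N. block_kernel S chi n q p * inv_kernel N p j)" for j
    unfolding map_kernel_def
    by (intro sum.cong refl) (simp add: block_kernel_sym[of _ _ _ q] inv_kernel_sym[of _ j] mult.commute)
  thus ?thesis by (simp only: kernel_compose)
qed

lemma map_kernel_outside: "q div n \<notin> S \<Longrightarrow> map_kernel S chi N n j q = 0"
  by (auto simp: map_kernel_def block_kernel_def intro!: sum.neutral)

text \<open>
  The point \<open>q\<close> with offset \<open>l = q mod n\<close> in its block should be mapped to \<open>j\<close> close to \<open>M * l\<close>. The
  corresponding entry is an exponential sum of frequency \<open>j/N - l/n\<close> with weight \<open>chi\<close>, so it decays
  to any prescribed order in the deviation. The second cutoff confines \<open>l/n\<close> to a compact subset of
  \<open>(0, 1)\<close>, which excludes the frequencies near \<open>\<plusminus>1\<close> where the sum would be large again.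
\<close>

lemma map_kernel_decay:
  assumes "cutoff chi"
  obtains C where "C \<ge> 0" "\<And>M S n j q E. \<lbrakk>M > 0; n > 0; j < M * n; q < M * n; E > 0;
      E \<le> \<bar>real j / real M - real (q mod n)\<bar>\<rbrakk> \<Longrightarrow> cmod (map_kernel S chi (M * n) n j q) \<le> C / E ^ K"
proof -
  obtain c where c: "0 < c" "c < 1" "\<And>x. chi x \<noteq> 0 \<Longrightarrow> c \<le> x \<and> x \<le> 1 - c"
    using cutoff_margin[OF assms] by blast
  obtain C where C: "C \<ge> 0" "\<And>n x. 0 < n \<Longrightarrow> \<bar>x\<bar> \<le> 1 - c \<Longrightarrow>
      (real n * \<bar>x\<bar>) ^ K * cmod (\<Sum>m<n. of_real (chi (real m / real n)) * cis (2 * pi * x) ^ m) \<le> C * real n"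
    using cutoff_sum_decay[OF assms c(1), of K] by blast
  have chi: "0 \<le> chi x" "chi x \<le> 1" for x using assms by (auto simp: cutoff_def)
  show ?thesis
  proof (rule that[OF C(1)])
    fix M n j q :: nat and S :: "nat set" and E :: real
    assume M: "M > 0" and n: "n > 0" and j: "j < M * n" and q: "q < M * n" and E: "E > 0"
      "E \<le> \<bar>real j / real M - real (q mod n)\<bar>"
    define a where "a = q div n"
    define l where "l = q mod n"
    have q_eq: "q = a * n + l" and l: "l < n" and a: "a < M"
      using n q by (simp_all add: a_def l_def less_mult_imp_div_less)
    show "cmod (map_kernel S chi (M * n) n j q) \<le> C / E ^ K"
    proof (cases "a \<in> S \<and> chi (real l / real n) \<noteq> 0")
      case False
      hence "map_kernel S chi (M * n) n j q = 0"
        by (auto simp: map_kernel_def block_kernel_def a_def l_def intro!: sum.neutral)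
      thus ?thesis using C(1) E by simp
    next
      case True
      define x where "x = real j / real (M * n) - real l / real n"
      define s where "s = (\<Sum>m<n. of_real (chi (real m / real n)) * cis (2 * pi * x) ^ m)"
      have jN: "0 \<le> real j / real (M * n)" "real j / real (M * n) < 1"
        using j by (simp_all add: divide_less_eq flip: of_nat_mult)
      have "c \<le> real l / real n \<and> real l / real n \<le> 1 - c" using c(3) True by blast
      with jN have x: "\<bar>x\<bar> \<le> 1 - c" unfolding x_def by linarith
      have nx: "real n * \<bar>x\<bar> = \<bar>real j / real M - real l\<bar>"
      proof -
        have "real n * x = real j / real M - real l" using n M by (simp add: x_def field_simps)
        thus ?thesis by (metis abs_mult abs_of_nat)
      qed
      have phase: "echar (M * n) (int j * int m) * cnj (echar n (int m * int l)) = cis (2 * pi * x) ^ m" for m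
        unfolding cnj_echar using n M
        unfolding echar_def cis_mult Complex.DeMoivre x_def by (intro arg_cong[where f = cis]) (simp add: field_simps)
      have "map_kernel S chi (M * n) n j q =
        (\<Sum>p<M * n. block_kernel S chi n (a * n + l) p * inv_kernel (M * n) j p)"
        unfolding map_kernel_def q_eq by (simp add: block_kernel_sym[of _ _ _ "a * n + l"] mult.commute)
      also have "\<dots> = (\<Sum>m<n. block_kernel S chi n (a * n + l) (a * n + m) * inv_kernel (M * n) j (a * n + m))"
        by (rule block_kernel_sum[OF l a])
      also have "\<dots> = (\<Sum>m<n. (of_real (chi (real l / real n)) * echar (M * n) (int j * int (a * n)) /
          (of_real (sqrt (real (M * n))) * of_real (sqrt (real n)))) *
          (of_real (chi (real m / real n)) * cis (2 * pi * x) ^ m))"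
      proof (intro sum.cong refl)
        fix m assume "m \<in> {..<n}"
        hence m: "m < n" by simp
        have "echar (M * n) (int j * int (a * n + m)) = echar (M * n) (int j * int (a * n)) * echar (M * n) (int j * int m)"
          by (simp add: distrib_left flip: echar_add)
        moreover have "block_kernel S chi n (a * n + l) (a * n + m) = of_real (chi (real l / real n)) *
            (cnj (echar n (int m * int l)) / of_real (sqrt (real n))) * of_real (chi (real m / real n))"
          using True m l by (simp add: block_kernel_def mult.commute[of "int m"])
        ultimately show "block_kernel S chi n (a * n + l) (a * n + m) * inv_kernel (M * n) j (a * n + m) =
          (of_real (chi (real l / real n)) * echar (M * n) (int j * int (a * n)) /
          (of_real (sqrt (real (M * n))) * of_real (sqrt (real n)))) *
          (of_real (chi (real m / real n)) * cis (2 * pi * x) ^ m)"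
          unfolding phase[symmetric] by (simp add: inv_kernel_def mult_ac)
      qed
      also have "\<dots> = of_real (chi (real l / real n)) * echar (M * n) (int j * int (a * n)) /
          (of_real (sqrt (real (M * n))) * of_real (sqrt (real n))) * s"
        by (simp only: s_def sum_distrib_left)
      finally have "cmod (map_kernel S chi (M * n) n j q) =
          chi (real l / real n) * cmod s / (sqrt (real (M * n)) * sqrt (real n))"
        using chi by (simp add: norm_mult norm_divide)
      also have "\<dots> \<le> 1 * cmod s / (sqrt (real n) * sqrt (real n))"
        using chi n M by (intro frac_le mult_right_mono mult_left_mono) auto
      finally have le: "cmod (map_kernel S chi (M * n) n j q) \<le> cmod s / real n" by simp
      have "E ^ K * cmod s \<le> (real n * \<bar>x\<bar>) ^ K * cmod s"
        using E unfolding nx l_def by (intro mult_right_mono power_mono) auto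
      also have "\<dots> \<le> C * real n" unfolding s_def by (rule C(2)[OF n x])
      finally have "cmod s / real n \<le> C / E ^ K" using E n by (simp add: field_simps)
      with le show ?thesis by linarith
    qed
  qed
qed

section \<open>Localization of an eigenfunction in position and frequency\<close>

lemma l2norm_restrict:
  assumes "\<And>v. l2norm B (\<lambda>j. \<Sum>q\<in>B. k j q * v q) \<le> l2norm B v" "finite B" "A \<subseteq> B" "J \<subseteq> B"
  shows "l2norm J (\<lambda>j. \<Sum>q\<in>A. k j q * v q) \<le> l2norm A v"
proof -
  define w where "w q = (if q \<in> A then v q else 0)" for q
  have "(\<Sum>q\<in>B. k j q * w q) = (\<Sum>q\<in>A. k j q * v q)" for j
    using assms(2,3) by (intro sum.mono_neutral_cong_right) (auto simp: w_def)
  moreover have "l2norm B w = l2norm A v"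
    unfolding L2_set_def using assms(2,3)
    by (intro arg_cong[where f = sqrt] sum.mono_neutral_cong_right) (auto simp: w_def)
  ultimately show ?thesis
    using assms(1)[of w] l2norm_subset[OF assms(2,4), of "\<lambda>j. \<Sum>q\<in>A. k j q * v q"] by simp
qed

lemma l2norm_small_kernel:
  assumes "finite A" "card A \<le> N" "finite J" "card J \<le> N" "d \<ge> 0"
    and "\<And>j q. j \<in> J \<Longrightarrow> q \<in> A \<Longrightarrow> cmod (k j q) \<le> d"
  shows "l2norm J (\<lambda>j. \<Sum>q\<in>A. k j q * v q) \<le> real N * d * l2norm A v"
proof -
  have sum_le: "(\<Sum>q\<in>A. cmod (v q)) \<le> sqrt (real N) * l2norm A v"
  proof -
    have "(\<Sum>q\<in>A. cmod (v q)) \<le> l2norm A v * sqrt (real (card A))"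
      using L2_set_mult_ineq[of "\<lambda>q. cmod (v q)" "\<lambda>_. 1" A] by (simp add: L2_set_constant)
    also have "\<dots> \<le> l2norm A v * sqrt (real N)"
      using assms(2) by (intro mult_left_mono) auto
    finally show ?thesis by (simp add: mult.commute)
  qed
  have "l2norm J (\<lambda>j. \<Sum>q\<in>A. k j q * v q) \<le> L2_set (\<lambda>j. d * (sqrt (real N) * l2norm A v)) J"
  proof (rule L2_set_mono)
    fix j assume "j \<in> J"
    have "cmod (\<Sum>q\<in>A. k j q * v q) \<le> (\<Sum>q\<in>A. d * cmod (v q))"
      using assms(6) \<open>j \<in> J\<close> by (intro sum_norm_le) (simp add: norm_mult mult_right_mono)
    also have "\<dots> \<le> d * (sqrt (real N) * l2norm A v)"
      using mult_left_mono[OF sum_le assms(5)] by (simp add: sum_distrib_left)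
    finally show "cmod (\<Sum>q\<in>A. k j q * v q) \<le> d * (sqrt (real N) * l2norm A v)" .
  qed simp
  also have "\<dots> = sqrt (real (card J)) * (d * (sqrt (real N) * l2norm A v))"
    using assms(5) by (simp add: L2_set_constant)
  also have "\<dots> \<le> sqrt (real N) * (d * (sqrt (real N) * l2norm A v))"
    using assms(4,5) by (intro mult_right_mono) auto
  also have "\<dots> = (sqrt (real N) * sqrt (real N)) * d * l2norm A v" by (simp only: mult_ac)
  finally show ?thesis by simp
qed

lemma quadratic_bound:
  fixes y :: real
  assumes "y\<^sup>2 \<le> a * y + e" "a \<ge> 0" "e \<ge> 0" "y \<ge> 0"
  shows "y \<le> a + sqrt e"
proof (rule ccontr)
  assume "\<not> y \<le> a + sqrt e"
  hence less: "a + sqrt e < y" by simp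
  have "y > 0" using less assms(2) real_sqrt_ge_zero[OF assms(3)] by linarith
  hence "y * (a + sqrt e) < y * y" using less by simp
  moreover have "sqrt e * sqrt e \<le> y * sqrt e"
    using less assms(2,3) by (intro mult_right_mono) auto
  ultimately show False using assms by (simp add: power2_eq_square algebra_simps)
qed

text \<open>
  By the hypothesis \<open>small\<close>, the kernel \<open>b\<close> carries almost nothing from outside \<open>X (Suc i)\<close> into \<open>X i\<close>.
  Applying \<open>b\<close> repeatedly to the eigenvector \<open>u\<close> shows that \<open>u\<close> has mass
  at least about \<open>cmod \<mu> ^ i\<close> on \<open>X i\<close>; applying the transpose to \<open>w\<close> shows that \<open>w\<close> has mass at most
  \<open>i * N * d / cmod \<mu> ^ i\<close> off \<open>X i\<close>. As \<open>G\<close> maps \<open>w\<close> to \<open>u\<close>, the norm of \<open>G\<close> on \<open>X r\<close> then bounds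
  \<open>cmod \<mu> ^ r\<close>.
\<close>

lemma localized_eigenvalue_bound:
  fixes G b :: "nat \<Rightarrow> nat \<Rightarrow> complex" and X :: "nat \<Rightarrow> nat set" and N :: nat
  defines "U \<equiv> {..<N}"
  assumes G: "\<And>v. l2norm U (\<lambda>j. \<Sum>p\<in>U. G j p * v p) \<le> l2norm U v"
    and B: "\<And>v. l2norm U (\<lambda>j. \<Sum>q\<in>U. b j q * v q) \<le> l2norm U v"
    and BT: "\<And>v. l2norm U (\<lambda>q. \<Sum>j\<in>U. b j q * v j) \<le> l2norm U v"
    and u: "\<And>j. j \<in> U \<Longrightarrow> u j = (\<Sum>p\<in>U. G j p * w p)"
    and eig_u: "\<And>j. j \<in> U \<Longrightarrow> \<mu> * u j = (\<Sum>q\<in>U. b j q * u q)"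
    and eig_w: "\<And>q. q \<in> U \<Longrightarrow> \<mu> * w q = (\<Sum>j\<in>U. b j q * w j)"
    and X: "X 0 = U" "\<And>i. X i \<subseteq> U" and d: "d \<ge> 0"
    and small: "\<And>i j q. j \<in> X i \<Longrightarrow> q \<in> U - X (Suc i) \<Longrightarrow> cmod (b j q) \<le> d"
    and \<Phi>: "\<And>v. l2norm (X r) (\<lambda>j. \<Sum>p\<in>X r. G j p * v p) \<le> \<Phi> * l2norm (X r) v" "\<Phi> \<ge> 0"
    and norms: "l2norm U u = 1" "l2norm U w \<le> 1" and \<mu>: "cmod \<mu> \<le> 1"
  shows "(cmod \<mu> ^ r)\<^sup>2 \<le> \<Phi> * cmod \<mu> ^ r + 2 * (real r * (real N * d))"
proof -
  have finU: "finite U" by (simp add: U_def)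
  have finX: "finite (X i)" for i using X(2) finU finite_subset by blast
  have card: "card A \<le> N" if "A \<subseteq> U" for A
    using card_mono[OF finU that] by (simp add: U_def)
  have Nd: "real N * d \<ge> 0" using d by simp
  have le1: "l2norm A u \<le> 1" "l2norm A w \<le> 1" if "A \<subseteq> U" for A
    using l2norm_subset[OF finU that] norms by (force intro: order.trans)+
  have position: "cmod \<mu> ^ i \<le> l2norm (X i) u + real i * (real N * d)" for i
  proof (induction i)
    case 0
    thus ?case by (simp add: X(1) norms)
  next
    case (Suc i)
    have "cmod \<mu> * l2norm (X i) u = l2norm (X i) (\<lambda>j. \<mu> * u j)" by (simp only: l2norm_scale)
    also have "\<dots> = l2norm (X i) (\<lambda>j. \<Sum>q\<in>U. b j q * u q)"
      using eig_u X(2) by (intro L2_set_cong refl) (metis subsetD)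
    also have "\<dots> \<le> l2norm (X i) (\<lambda>j. \<Sum>q\<in>X (Suc i). b j q * u q)
        + l2norm (X i) (\<lambda>j. \<Sum>q\<in>U - X (Suc i). b j q * u q)"
      by (rule l2norm_split[OF finU X(2)])
    also have "\<dots> \<le> l2norm (X (Suc i)) u + real N * d * l2norm (U - X (Suc i)) u"
      by (intro add_mono l2norm_restrict[OF B finU] l2norm_small_kernel card X(2) finX d small)
        (use finU in auto)
    also have "\<dots> \<le> l2norm (X (Suc i)) u + real N * d"
      using mult_left_mono[OF le1(1)[of "U - X (Suc i)"] Nd] by auto
    finally have step: "cmod \<mu> * l2norm (X i) u \<le> l2norm (X (Suc i)) u + real N * d" .
    have "cmod \<mu> ^ Suc i \<le> cmod \<mu> * (l2norm (X i) u + real i * (real N * d))"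
      using Suc by (simp add: mult_left_mono)
    also have "\<dots> \<le> cmod \<mu> * l2norm (X i) u + 1 * (real i * (real N * d))"
      using mult_right_mono[OF \<mu>, of "real i * (real N * d)"] Nd by (simp add: distrib_left)
    finally show ?case using step by (simp add: distrib_right)
  qed
  have frequency: "cmod \<mu> ^ i * l2norm (U - X i) w \<le> real i * (real N * d)" for i
  proof (induction i)
    case 0
    thus ?case by (simp add: X(1))
  next
    case (Suc i)
    have "cmod \<mu> * l2norm (U - X (Suc i)) w = l2norm (U - X (Suc i)) (\<lambda>q. \<mu> * w q)" by (simp only: l2norm_scale)
    also have "\<dots> = l2norm (U - X (Suc i)) (\<lambda>q. \<Sum>j\<in>U. b j q * w j)"
      using eig_w by (intro L2_set_cong refl) auto
    also have "\<dots> \<le> l2norm (U - X (Suc i)) (\<lambda>q. \<Sum>j\<in>X i. b j q * w j)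
        + l2norm (U - X (Suc i)) (\<lambda>q. \<Sum>j\<in>U - X i. b j q * w j)"
      by (rule l2norm_split[OF finU X(2)])
    also have "\<dots> \<le> real N * d * l2norm (X i) w + l2norm (U - X i) w"
      by (intro add_mono l2norm_restrict[where k = "\<lambda>q j. b j q", OF BT finU]
            l2norm_small_kernel[where k = "\<lambda>q j. b j q"] card X(2) finX d small)
        (use finU in auto)
    also have "\<dots> \<le> real N * d + l2norm (U - X i) w"
      using mult_left_mono[OF le1(2)[OF X(2)] Nd] by auto
    finally have "cmod \<mu> ^ i * (cmod \<mu> * l2norm (U - X (Suc i)) w) \<le>
        cmod \<mu> ^ i * (real N * d + l2norm (U - X i) w)"
      by (rule mult_left_mono) simp
    also have "\<dots> \<le> 1 * (real N * d) + cmod \<mu> ^ i * l2norm (U - X i) w"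
      using mult_right_mono[OF power_le_one[OF _ \<mu>] Nd, of i] by (simp add: distrib_left)
    finally have "cmod \<mu> ^ Suc i * l2norm (U - X (Suc i)) w \<le>
        real N * d + cmod \<mu> ^ i * l2norm (U - X i) w" by (simp add: mult_ac)
    thus ?case using Suc by (simp add: distrib_right)
  qed
  define y where "y = cmod \<mu> ^ r"
  have y: "0 \<le> y" "y \<le> 1" using \<mu> by (auto simp: y_def power_le_one)
  have "l2norm (X r) u = l2norm (X r) (\<lambda>j. \<Sum>p\<in>U. G j p * w p)"
    using u X(2) by (intro L2_set_cong refl) (metis subsetD)
  also have "\<dots> \<le> l2norm (X r) (\<lambda>j. \<Sum>p\<in>X r. G j p * w p) + l2norm (X r) (\<lambda>j. \<Sum>p\<in>U - X r. G j p * w p)"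
    by (rule l2norm_split[OF finU X(2)])
  also have "\<dots> \<le> \<Phi> * l2norm (X r) w + l2norm (U - X r) w"
    by (intro add_mono l2norm_restrict[OF G finU] \<Phi> X(2)) auto
  also have "\<dots> \<le> \<Phi> + l2norm (U - X r) w"
    using mult_left_mono[OF le1(2)[OF X(2)] \<Phi>(2)] by auto
  finally have "y \<le> \<Phi> + l2norm (U - X r) w + real r * (real N * d)"
    using position[of r] by (simp add: y_def)
  hence "y * y \<le> y * (\<Phi> + l2norm (U - X r) w + real r * (real N * d))"
    by (rule mult_left_mono) (rule y)
  also have "\<dots> \<le> \<Phi> * y + real r * (real N * d) + 1 * (real r * (real N * d))"
    using frequency[of r] mult_right_mono[OF y(2) mult_nonneg_nonneg[OF of_nat_0_le_iff Nd], of r]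
    unfolding y_def distrib_left mult.commute[of \<Phi>] by linarith
  finally show ?thesis unfolding y_def power2_eq_square by linarith
qed

text \<open>
  The points that, up to an error \<open>E\<close> in each step, stay in blocks of the alphabet for \<open>i\<close> steps of the
  expanding map. They are built by inverse branches, which contract, so that the errors do not
  accumulate.
\<close>

primrec trapped :: "nat \<Rightarrow> nat set \<Rightarrow> nat \<Rightarrow> real \<Rightarrow> nat \<Rightarrow> nat set" where
  "trapped M S n E 0 = {..<M * n}"
| "trapped M S n E (Suc i) = {q. q < M * n \<and> q div n \<in> S \<and>
     (\<exists>j\<in>trapped M S n E i. \<bar>real j / real M - real (q mod n)\<bar> < E)}"

lemma trapped_subset: "trapped M S n E i \<subseteq> {..<M * n}"
  by (cases i) auto

text \<open>
  An inverse branch prepends a digit and divides the error made so far by \<open>M\<close>, so an error bound of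
  \<open>2 * E\<close> reproduces itself as soon as \<open>M \<ge> 2\<close>.
\<close>

lemma trapped_near_cantor:
  assumes "M \<ge> 2" "S \<noteq> {}" "E \<ge> 0" "k > 0" "i \<le> k" "q \<in> trapped M S (M ^ (k - 1)) E i"
  shows "\<exists>c\<in>cantor M S i. \<bar>real q - real (c * M ^ (k - i))\<bar> \<le> real (M ^ (k - i)) + 2 * E"
  using assms(5,6)
proof (induction i arbitrary: q)
  case 0
  have "M * M ^ (k - 1) = M ^ k" using assms(4) by (cases k) auto
  hence "real q < real (M ^ k)" using 0 by (simp del: of_nat_power)
  hence "real q \<le> real (M ^ k) + 2 * E" using assms(3) by linarith
  thus ?case using assms(2) by (simp add: cantor_0)
next
  case (Suc i)
  define n where "n = M ^ (k - 1)"
  define P where "P = M ^ (k - Suc i)"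
  have "k - i = Suc (k - Suc i)" using Suc.prems(1) by simp
  hence MP: "M ^ (k - i) = M * P" by (simp only: P_def power_Suc)
  have n: "n = M ^ i * P" using Suc.prems(1) by (simp add: P_def n_def flip: power_add)
  obtain j where j: "j \<in> trapped M S n E i" "q div n \<in> S" "\<bar>real j / real M - real (q mod n)\<bar> < E"
    using Suc.prems(2) by (auto simp: n_def)
  obtain c where c: "c \<in> cantor M S i" "\<bar>real j - real (c * M ^ (k - i))\<bar> \<le> real (M ^ (k - i)) + 2 * E"
    using Suc.IH[of j] Suc.prems(1) j(1) by (auto simp: n_def)
  have "M ^ i * (q div n) + c \<in> cantor M S (Suc i)"
    using c(1) j(2) by (auto simp: cantor_Suc_high)
  moreover have "\<bar>real q - real ((M ^ i * (q div n) + c) * P)\<bar> \<le> real P + 2 * E"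
  proof -
    have q: "real q = real (M ^ i * (q div n) * P) + real (q mod n)"
      using div_mult_mod_eq[of q n] unfolding of_nat_add[symmetric] of_nat_eq_iff by (simp add: n mult_ac)
    have M: "real M > 0" using assms(1) by simp
    have "\<bar>real j / real M - real (c * P)\<bar> = \<bar>real j - real (c * M ^ (k - i))\<bar> / real M"
      using M by (simp add: MP field_simps)
    also have "\<dots> \<le> (real (M * P) + 2 * E) / real M"
      using c(2) M by (intro divide_right_mono) (simp_all add: MP)
    also have "\<dots> = real P + 2 * E / real M" using M by (simp add: field_simps)
    also have "2 * E / real M \<le> E"
      using assms(1,3) M mult_right_mono[of 2 "real M" E] by (simp add: divide_le_eq mult.commute)
    finally have "\<bar>real j / real M - real (c * P)\<bar> \<le> real P + E" by simp
    thus ?thesis using j(3) unfolding q by (simp add: algebra_simps abs_le_iff abs_less_iff)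
  qed
  ultimately show ?case unfolding P_def by blast
qed

text \<open>
  A trapped set for \<open>k - m\<close> steps at the scale \<open>M ^ m\<close> is covered by at most \<open>9 * M ^ m\<close> translates of the
  Cantor set with all \<open>k\<close> digits.
\<close>

lemma trapped_uncertainty:
  assumes M: "M \<ge> 2" and S: "S \<subseteq> {..<M}" "S \<noteq> {}" and \<kappa>: "\<kappa> \<ge> 0" "fourier_bound M S S \<kappa>"
    and k: "k > 0" "m \<le> k"
  defines "X \<equiv> trapped M S (M ^ (k - 1)) (real (M ^ m)) (k - m)"
  shows "l2norm X (\<lambda>j. \<Sum>p\<in>X. inv_kernel (M ^ k) j p * v p) \<le> 9 * real M ^ m * sqrt (\<kappa> / real M) ^ k * l2norm X v"
proof -
  \<comment> \<open>Localization accounts for a displacement of \<open>3 * M ^ m\<close>, filling up the last \<open>m\<close> digits for \<open>M ^ m\<close>.\<close>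
  define T where "T = {- int (4 * M ^ m)..int (4 * M ^ m)}"
  have X: "X \<subseteq> {..<M ^ k}" using trapped_subset[of M S "M ^ (k - 1)"] k(1) unfolding X_def
    by (cases k) auto
  have Mm: "M ^ m > 0" using M by simp
  have cover: "\<exists>c\<in>cantor M S k. \<exists>s\<in>T. int j = int c + s" if "j \<in> X" for j
  proof -
    obtain c where c: "c \<in> cantor M S (k - m)"
      "\<bar>real j - real (c * M ^ (k - (k - m)))\<bar> \<le> real (M ^ (k - (k - m))) + 2 * real (M ^ m)"
      using trapped_near_cantor[OF M S(2) _ k(1), of "real (M ^ m)" "k - m" j] \<open>j \<in> X\<close> by (auto simp: X_def)
    obtain y where y: "y \<in> cantor M S (k - m + m)" "c * M ^ m \<le> y" "y < (c + 1) * M ^ m"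
      using cantor_shift[OF S c(1)] by blast
    have "\<bar>real j - real (c * M ^ m)\<bar> \<le> real (3 * M ^ m)" using c(2) k(2) by simp
    hence "real_of_int \<bar>int j - int (c * M ^ m)\<bar> \<le> real_of_int (int (3 * M ^ m))"
      by simp
    hence "\<bar>int j - int (c * M ^ m)\<bar> \<le> int (3 * M ^ m)"
      by (simp only: of_int_le_iff)
    moreover have "int (c * M ^ m) \<le> int y" "int y < int (c * M ^ m) + int (M ^ m)"
      using y(2,3) by (simp_all only: of_nat_le_iff of_nat_less_iff of_nat_add[symmetric] add_mult_distrib mult_1)
    ultimately have "int j - int y \<in> T" by (simp only: T_def atLeastAtMost_iff of_nat_mult of_nat_numeral) linarith
    thus ?thesis using y(1) k(2) by (intro bexI[of _ y] bexI[of _ "int j - int y"]) auto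
  qed
  have cardT: "real (card T) \<le> 9 * real M ^ m"
  proof -
    have "card T = nat (int (4 * M ^ m) - - int (4 * M ^ m) + 1)"
      unfolding T_def by (rule card_atLeastAtMost_int)
    also have "\<dots> = 8 * M ^ m + 1" by linarith
    finally have "card T = 8 * M ^ m + 1" .
    moreover have "8 * M ^ m + 1 \<le> 9 * M ^ m" using Mm by linarith
    ultimately have "real (card T) \<le> real (9 * M ^ m)" by (simp only: of_nat_le_iff)
    thus ?thesis by simp
  qed
  have "finite (cantor M S k)" using cantor_less[OF S] finite_subset by blast
  moreover have "fourier_bound (M ^ k) (cantor M S k) (cantor M S k) (\<kappa> ^ k)"
    using M S \<kappa> by (intro fourier_bound_cantor) auto
  ultimately have "fourier_bound (M ^ k) X X ((real (card T))\<^sup>2 * \<kappa> ^ k)"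
    using cover X \<kappa>(1) finite_subset[OF X] by (intro fourier_bound_translates[where T = T]) (auto simp: T_def)
  hence fb: "(\<Sum>j\<in>X. (cmod (\<Sum>p\<in>X. echar (M ^ k) (int j * int p) * v p))\<^sup>2) \<le>
      (real (card T))\<^sup>2 * \<kappa> ^ k * (\<Sum>p\<in>X. (cmod (v p))\<^sup>2)" unfolding fourier_bound_def by blast
  have "l2norm X (\<lambda>j. \<Sum>p\<in>X. inv_kernel (M ^ k) j p * v p) =
    sqrt ((\<Sum>j\<in>X. (cmod (\<Sum>p\<in>X. echar (M ^ k) (int j * int p) * v p))\<^sup>2) / real M ^ k)"
    by (simp add: L2_set_def inv_kernel_def norm_divide power_divide norm_power flip: sum_divide_distrib)
  also have "\<dots> \<le> sqrt (((real (card T))\<^sup>2 * \<kappa> ^ k * (\<Sum>p\<in>X. (cmod (v p))\<^sup>2)) / real M ^ k)"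
    by (intro real_sqrt_le_mono divide_right_mono fb) simp
  also have "\<dots> = real (card T) * sqrt (\<kappa> / real M) ^ k * l2norm X v"
    by (simp add: L2_set_def real_sqrt_mult real_sqrt_divide real_sqrt_power power_divide)
  also have "\<dots> \<le> 9 * real M ^ m * sqrt (\<kappa> / real M) ^ k * l2norm X v"
    using \<kappa>(1) by (intro mult_right_mono cardT) auto
  finally show ?thesis .
qed

section \<open>From a Fourier bound for the alphabet to a spectral gap\<close>

text \<open>
  The tolerated error is \<open>M ^ m\<close>, the length of the intervals that make up the Cantor set after \<open>k - m\<close>
  digits. Up to a constant it is the largest one that thickens these intervals only by a constant
  factor, and the larger it is, the smaller are the entries that violate it.
\<close>

lemma eigenvalue_power_bound:
  assumes "cutoff chi"
  obtains C where "C \<ge> 0" "\<And>M S \<kappa> k m \<mu>. \<lbrakk>M \<ge> 2; S \<subseteq> {..<M}; S \<noteq> {}; \<kappa> \<ge> 0; fourier_bound M S S \<kappa>;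
      k > 0; m \<le> k; \<mu> \<in> spectrum (open_quantum_map M S chi (M ^ k))\<rbrakk> \<Longrightarrow>
      cmod \<mu> ^ k \<le> 9 * real M ^ m * sqrt (\<kappa> / real M) ^ k + sqrt (2 * (real k * (real M ^ k * (C / (real M ^ m) ^ K))))"
proof -
  obtain C where C: "C \<ge> 0" "\<And>M S n j q E. \<lbrakk>M > 0; n > 0; j < M * n; q < M * n; E > 0;
      E \<le> \<bar>real j / real M - real (q mod n)\<bar>\<rbrakk> \<Longrightarrow> cmod (map_kernel S chi (M * n) n j q) \<le> C / E ^ K"
    using map_kernel_decay[OF assms] by blast
  have chi: "0 \<le> chi x \<and> chi x \<le> 1" for x using assms by (auto simp: cutoff_def)
  show ?thesis
  proof (rule that[OF C(1)])
    fix M k m :: nat and S :: "nat set" and \<kappa> :: real and \<mu>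
    assume M: "M \<ge> 2" and S: "S \<subseteq> {..<M}" "S \<noteq> {}" and \<kappa>: "\<kappa> \<ge> 0" "fourier_bound M S S \<kappa>"
      and k: "k > 0" "m \<le> k" and \<mu>: "\<mu> \<in> spectrum (open_quantum_map M S chi (M ^ k))"
    define n where "n = M ^ (k - 1)"
    define N where "N = M ^ k"
    define E where "E = real (M ^ m)"
    define d where "d = C / E ^ K"
    define X where "X = trapped M S n E"
    have n: "n > 0" and M0: "M > 0" and E: "E > 0"
      using M by (simp_all add: n_def E_def)
    have N: "N = M * n"
      using k(1) unfolding N_def n_def by (cases k) simp_all
    have d: "d \<ge> 0" using C(1) E by (simp add: d_def)
    obtain u w where uw: "l2norm {..<N} u = 1"
      "\<And>j. j < N \<Longrightarrow> u j = (\<Sum>p<N. inv_kernel N j p * w p)"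
      "\<And>p. p < N \<Longrightarrow> \<mu> * w p = (\<Sum>q<N. block_kernel S chi n p q * u q)"
      using open_quantum_map_eigenpair[OF n N M0, of \<mu> S chi] \<mu> unfolding N_def by blast
    have norm_w: "l2norm {..<N} w = 1"
    proof -
      have "l2norm {..<N} u = l2norm {..<N} (\<lambda>j. \<Sum>p<N. inv_kernel N j p * w p)"
        using uw(2) by (intro L2_set_cong refl) auto
      thus ?thesis using uw(1) inv_kernel_isometry by simp
    qed
    have contraction: "l2norm {..<N} (\<lambda>p. \<Sum>q<N. block_kernel S chi n p q * v q) \<le> l2norm {..<N} v" for v
      unfolding N by (rule block_kernel_contraction[OF n chi])
    have \<mu>1: "cmod \<mu> \<le> 1"
    proof -
      have "cmod \<mu> = l2norm {..<N} (\<lambda>p. \<mu> * w p)" by (simp only: l2norm_scale norm_w)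
      also have "\<dots> = l2norm {..<N} (\<lambda>p. \<Sum>q<N. block_kernel S chi n p q * u q)"
        using uw(3) by (intro L2_set_cong refl) auto
      also have "\<dots> \<le> 1" using contraction[of u] uw(1) by simp
      finally show ?thesis .
    qed
    have "(cmod \<mu> ^ (k - m))\<^sup>2 \<le> (9 * real M ^ m * sqrt (\<kappa> / real M) ^ k) * cmod \<mu> ^ (k - m)
        + 2 * (real (k - m) * (real N * d))"
    proof (rule localized_eigenvalue_bound[where X = X and u = u and w = w and G = "inv_kernel N" and b = "map_kernel S chi N n"])
      show "l2norm {..<N} (\<lambda>j. \<Sum>p<N. inv_kernel N j p * v p) \<le> l2norm {..<N} v" for v
        by (simp only: inv_kernel_isometry)
      show "l2norm {..<N} (\<lambda>j. \<Sum>q<N. map_kernel S chi N n j q * v q) \<le> l2norm {..<N} v" for v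
        unfolding map_kernel_apply inv_kernel_isometry by (rule contraction)
      show "l2norm {..<N} (\<lambda>q. \<Sum>j<N. map_kernel S chi N n j q * v j) \<le> l2norm {..<N} v" for v
        unfolding map_kernel_apply_transpose
        using contraction[of "\<lambda>p. \<Sum>j<N. inv_kernel N p j * v j"] by (simp only: inv_kernel_isometry)
      fix j assume j: "j \<in> {..<N}"
      show "u j = (\<Sum>p<N. inv_kernel N j p * w p)" using uw(2) j by simp
      have "(\<Sum>q<N. map_kernel S chi N n j q * u q) = (\<Sum>p<N. inv_kernel N j p * (\<mu> * w p))"
        unfolding map_kernel_apply by (intro sum.cong refl) (simp add: uw(3))
      thus "\<mu> * u j = (\<Sum>q<N. map_kernel S chi N n j q * u q)"
        using j by (simp add: uw(2) sum_distrib_left mult_ac)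
      have "(\<Sum>i<N. map_kernel S chi N n i j * w i) = (\<Sum>p<N. block_kernel S chi n j p * u p)"
        unfolding map_kernel_apply_transpose by (intro sum.cong refl) (simp add: uw(2))
      thus "\<mu> * w j = (\<Sum>i<N. map_kernel S chi N n i j * w i)"
        using j by (simp add: uw(3))
    next
      show "X 0 = {..<N}" by (simp add: X_def N)
      show "X i \<subseteq> {..<N}" for i unfolding X_def N by (rule trapped_subset)
      show "cmod (map_kernel S chi N n j q) \<le> d" if jq: "j \<in> X i" "q \<in> {..<N} - X (Suc i)" for i j q
      proof (cases "q div n \<in> S")
        case True
        have "j < M * n" "q < M * n" using jq trapped_subset[of M S n E i] by (auto simp: X_def N)
        moreover have "E \<le> \<bar>real j / real M - real (q mod n)\<bar>"
          using jq True by (force simp: X_def N)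
        ultimately show ?thesis unfolding N d_def by (intro C(2) M0 n E)
      next
        case False
        thus ?thesis using d by (simp add: map_kernel_outside)
      qed
      show "l2norm (X (k - m)) (\<lambda>j. \<Sum>p\<in>X (k - m). inv_kernel N j p * v p) \<le>
          9 * real M ^ m * sqrt (\<kappa> / real M) ^ k * l2norm (X (k - m)) v" for v
        unfolding X_def N_def n_def E_def by (rule trapped_uncertainty[OF M S \<kappa> k])
    qed (use d uw norm_w \<mu>1 \<kappa> in auto)
    also have "2 * (real (k - m) * (real N * d)) \<le> 2 * (real k * (real N * d))"
      using d by (intro mult_left_mono mult_right_mono) auto
    finally have "cmod \<mu> ^ (k - m) \<le> 9 * real M ^ m * sqrt (\<kappa> / real M) ^ k + sqrt (2 * (real k * (real N * d)))"
      using d \<kappa>(1) by (intro quadratic_bound) auto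
    \<comment> \<open>The eigenvalue has modulus at most one, so nothing is lost by raising the exponent to \<open>k\<close>.\<close>
    moreover have "cmod \<mu> ^ k \<le> cmod \<mu> ^ (k - m)"
      using \<mu>1 by (intro power_decreasing) auto
    ultimately show "cmod \<mu> ^ k \<le> 9 * real M ^ m * sqrt (\<kappa> / real M) ^ k
        + sqrt (2 * (real k * (real M ^ k * (C / (real M ^ m) ^ K))))"
      by (simp add: N_def d_def E_def)
  qed
qed

lemma powr_inverse_tendsto_1: "x > 0 \<Longrightarrow> (\<lambda>q. x powr (1 / real (Suc q))) \<longlonglongrightarrow> 1"
proof -
  assume x: "x > 0"
  have "(\<lambda>q. 1 / real (Suc q)) \<longlonglongrightarrow> 0" by (rule LIMSEQ_Suc, real_asymp)
  from tendsto_powr[OF tendsto_const[of x] this] show ?thesis using x by simp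
qed

text \<open>
  Of the \<open>k\<close> digits, \<open>m = k div q\<close> are sacrificed as thickness. A large \<open>q\<close> makes the loss \<open>M ^ m\<close> of
  arbitrarily small exponential rate, and for a fixed \<open>q\<close> a sufficiently high order \<open>K\<close> of decay at the
  scale \<open>M ^ m\<close> makes the error term exponentially small at any prescribed rate.
\<close>

lemma spectral_radius_eventually_less:
  assumes chi: "cutoff chi" and M: "M \<ge> 2" and S: "S \<subseteq> {..<M}" "S \<noteq> {}"
    and \<kappa>: "\<kappa> \<ge> 0" "fourier_bound M S S \<kappa>" and t: "sqrt (\<kappa> / real M) < t"
  shows "\<forall>\<^sub>F k in sequentially. spectral_radius (open_quantum_map M S chi (M ^ k)) \<le> t"
proof -
  define \<tau> where "\<tau> = sqrt (\<kappa> / real M)"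
  have \<tau>: "\<tau> \<ge> 0" "\<tau> < t" using \<kappa> t by (simp_all add: \<tau>_def)
  have M1: "real M > 1" using M by simp
  have "(\<lambda>q. real M powr (1 / real (Suc q)) * \<tau>) \<longlonglongrightarrow> 1 * \<tau>"
    using M1 by (intro tendsto_intros powr_inverse_tendsto_1) auto
  hence "\<forall>\<^sub>F q in sequentially. real M powr (1 / real (Suc q)) * \<tau> < t"
    using \<tau> by (intro order_tendstoD) auto
  then obtain q0 where q0: "real M powr (1 / real (Suc q0)) * \<tau> < t"
    by (auto simp: eventually_sequentially)
  define q where "q = Suc q0"
  define \<alpha> where "\<alpha> = real M powr (1 / real q) * \<tau>"
  have \<alpha>: "\<alpha> \<ge> 0" "\<alpha> < t" using \<tau> q0 by (simp_all add: \<alpha>_def q_def)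
  have q: "q > 0" by (simp add: q_def)
  obtain p where p: "(1 / real M) ^ p < t\<^sup>2"
    using real_arch_pow_inv[of "t\<^sup>2" "1 / real M"] \<tau> M1 by auto
  define \<sigma> where "\<sigma> = sqrt ((1 / real M) ^ p)"
  have \<sigma>: "\<sigma> \<ge> 0" "\<sigma> < t" using p \<tau> by (auto simp: \<sigma>_def real_less_lsqrt)
  define K where "K = q * Suc p"
  obtain C where C: "C \<ge> 0" "\<And>M S \<kappa> k m \<mu>. \<lbrakk>M \<ge> 2; S \<subseteq> {..<M}; S \<noteq> {}; \<kappa> \<ge> 0; fourier_bound M S S \<kappa>;
      k > 0; m \<le> k; \<mu> \<in> spectrum (open_quantum_map M S chi (M ^ k))\<rbrakk> \<Longrightarrow>
      cmod \<mu> ^ k \<le> 9 * real M ^ m * sqrt (\<kappa> / real M) ^ k + sqrt (2 * (real k * (real M ^ k * (C / (real M ^ m) ^ K))))"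
    using eigenvalue_power_bound[OF chi, of K] by blast
  define D where "D = sqrt (2 * C * real M ^ (q * Suc p))"
  have D: "D \<ge> 0" using C(1) by (simp add: D_def)
  have bound: "cmod \<mu> ^ k \<le> 9 * \<alpha> ^ k + D * (real k * \<sigma> ^ k)"
    if k: "k > 0" and \<mu>: "\<mu> \<in> spectrum (open_quantum_map M S chi (M ^ k))" for k \<mu>
  proof -
    define m where "m = k div q"
    have m: "m \<le> k" by (simp add: m_def)
    have "real M ^ m * \<tau> ^ k \<le> \<alpha> ^ k"
    proof -
      have "real M ^ m = real M powr real m" using M1 by (simp add: powr_realpow)
      also have "\<dots> \<le> real M powr (real k / real q)"
      proof (rule powr_mono)
        have "m * q \<le> k" by (simp add: m_def)
        hence "real m * real q \<le> real k" by (simp only: of_nat_mult[symmetric] of_nat_le_iff)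
        thus "real m \<le> real k / real q" using q by (simp add: le_divide_eq)
      qed (use M1 in simp)
      also have "\<dots> = (real M powr (1 / real q)) ^ k"
        using M1 by (simp add: powr_powr flip: powr_realpow)
      finally show ?thesis using \<tau>(1) by (simp add: \<alpha>_def power_mult_distrib mult_right_mono)
    qed
    moreover have "sqrt (2 * (real k * (real M ^ k * (C / (real M ^ m) ^ K)))) \<le> D * (real k * \<sigma> ^ k)"
    proof -
      have "k \<le> q * m + q"
        using div_mult_mod_eq[of k q] mod_less_divisor[OF q, of k] unfolding m_def by (metis add_left_mono less_imp_le mult.commute)
      hence "(real M ^ k) ^ Suc p \<le> (real M ^ (q * m + q)) ^ Suc p"
        using M1 by (intro power_mono power_increasing) auto
      also have "\<dots> = (real M ^ m) ^ K * real M ^ (q * Suc p)"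
        by (simp only: K_def power_add power_mult_distrib flip: power_mult) (simp only: mult_ac)
      finally have "real M ^ k * (real M ^ k) ^ p \<le> (real M ^ m) ^ K * real M ^ (q * Suc p)" by simp
      hence "real M ^ k / (real M ^ m) ^ K \<le> real M ^ (q * Suc p) / (real M ^ k) ^ p"
        using M1 by (simp add: field_simps)
      also have "\<dots> = real M ^ (q * Suc p) * ((1 / real M) ^ p) ^ k"
        by (simp add: power_divide mult.commute flip: power_mult)
      finally have le: "real M ^ k / (real M ^ m) ^ K \<le> real M ^ (q * Suc p) * ((1 / real M) ^ p) ^ k" .
      have "2 * (real k * (real M ^ k * (C / (real M ^ m) ^ K))) = 2 * C * real k * (real M ^ k / (real M ^ m) ^ K)"
        by simp
      also have "\<dots> \<le> 2 * C * (real k)\<^sup>2 * (real M ^ (q * Suc p) * ((1 / real M) ^ p) ^ k)"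
        using C(1) k le by (intro mult_mono mult_nonneg_nonneg) (auto simp: power2_eq_square)
      also have "\<dots> = (2 * C * real M ^ (q * Suc p)) * ((real k)\<^sup>2 * ((1 / real M) ^ p) ^ k)" by (simp only: mult_ac)
      finally have "sqrt (2 * (real k * (real M ^ k * (C / (real M ^ m) ^ K)))) \<le>
          sqrt ((2 * C * real M ^ (q * Suc p)) * ((real k)\<^sup>2 * ((1 / real M) ^ p) ^ k))"
        by (rule real_sqrt_le_mono)
      also have "\<dots> = D * (real k * \<sigma> ^ k)"
        by (simp only: D_def \<sigma>_def real_sqrt_mult real_sqrt_power real_sqrt_abs power2_eq_square real_sqrt_mult_self abs_of_nat)
      finally show ?thesis .
    qed
    ultimately show ?thesis using C(2)[OF M S \<kappa> k m \<mu>] by (simp add: \<tau>_def)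
  qed
  have t0: "t > 0" using \<tau> by simp
  have "(\<lambda>k. 9 * (\<alpha> / t) ^ k + D * (real k * (\<sigma> / t) ^ k)) \<longlonglongrightarrow> 9 * 0 + D * 0"
    using \<alpha> \<sigma> t0 by (intro tendsto_intros LIMSEQ_power_zero powser_times_n_limit_0) auto
  hence "\<forall>\<^sub>F k in sequentially. 9 * (\<alpha> / t) ^ k + D * (real k * (\<sigma> / t) ^ k) < 1"
    by (intro order_tendstoD) auto
  thus ?thesis using eventually_gt_at_top[of 0]
  proof eventually_elim
    case (elim k)
    have "M dvd M ^ k" using elim(2) by simp
    hence "open_quantum_map M S chi (M ^ k) \<in> carrier_mat (M ^ k) (M ^ k)" by (rule open_quantum_map_carrier)
    from spectral_radius_mem_max(1)[OF this] M obtain \<mu> where \<mu>: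
      "\<mu> \<in> spectrum (open_quantum_map M S chi (M ^ k))" "spectral_radius (open_quantum_map M S chi (M ^ k)) = cmod \<mu>"
      by auto
    have "(9 * (\<alpha> / t) ^ k + D * (real k * (\<sigma> / t) ^ k)) * t ^ k < 1 * t ^ k"
      using elim(1) t0 by (intro mult_strict_right_mono) auto
    hence "9 * \<alpha> ^ k + D * (real k * \<sigma> ^ k) < t ^ k"
      using t0 by (simp add: power_divide distrib_right)
    hence "cmod \<mu> ^ k \<le> t ^ k" using bound[OF elim(2) \<mu>(1)] by linarith
    hence "cmod \<mu> \<le> t" using t0 elim(2) power_mono_iff[of "cmod \<mu>" t k] by simp
    thus ?case using \<mu>(2) by simp
  qed
qed

lemma has_spectral_gap_if_fourier_bound:
  assumes "cutoff chi" "M \<ge> 2" "S \<subseteq> {..<M}" "S \<noteq> {}" "fourier_bound M S S (real M powr (1 - 2 * \<beta>))"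
  shows "has_spectral_gap M S chi \<beta>"
  unfolding has_spectral_gap_def Limsup_le_iff
proof (intro allI impI)
  fix y assume "ereal (real M powr - \<beta>) < y"
  from ereal_dense2[OF this] obtain t where t: "ereal (real M powr - \<beta>) < ereal t" "ereal t < y"
    by blast
  have M: "real M > 0" using assms(2) by simp
  have "real M powr (1 - 2 * \<beta>) / real M = (real M powr - \<beta>)\<^sup>2"
    using M by (simp add: powr_diff power2_eq_square flip: powr_add) (simp add: powr_minus divide_simps)
  hence "sqrt (real M powr (1 - 2 * \<beta>) / real M) < t" using t(1) by simp
  from spectral_radius_eventually_less[OF assms(1-4) _ assms(5) this]
  have "\<forall>\<^sub>F k in sequentially. spectral_radius (open_quantum_map M S chi (M ^ k)) \<le> t" by simp
  thus "\<forall>\<^sub>F k in sequentially. ereal (spectral_radius (open_quantum_map M S chi (M ^ k))) < y"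
    by eventually_elim (use t(2) in \<open>auto intro: le_less_trans[of _ "ereal t"]\<close>)
qed

section \<open>Random alphabets\<close>

definition flat_alphabets :: "nat \<Rightarrow> nat \<Rightarrow> real \<Rightarrow> nat set set" where
  "flat_alphabets M A s = {S \<in> alphabets M A. \<forall>d\<in>{1..<M}. cmod (\<Sum>j\<in>S. echar M (int j * int d)) \<le> s}"

lemma measure_not_flat:
  assumes "0 < A" "A \<le> M" "s \<ge> 0"
  shows "measure (alphabet_measure M A) (alphabets M A - flat_alphabets M A s) \<le> 4 * real M * exp (- (s\<^sup>2 / (8 * real A)))"
proof -
  have eq: "alphabets M A - flat_alphabets M A s =
    {S \<in> alphabets M A. \<exists>d\<in>{1..<M}. cmod (\<Sum>j\<in>S. echar M (int j * int d)) > s}"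
    by (auto simp: flat_alphabets_def not_le)
  have "real (M choose A) > 0" using assms(2) by simp
  thus ?thesis using card_large_exponential_sum_le[OF assms]
    by (subst measure_alphabet_measure) (auto simp: eq divide_le_eq mult.commute)
qed

text \<open>
  Schur's test gives at most \<open>A\<^bsup>3/2\<^esup>\<sigma>\<close> for the alphabet, and with \<open>A = M\<^bsup>\<delta>\<^esup>\<close> this is \<open>M\<^bsup>1 - 2\<beta>\<^esup>\<close> for the
  claimed gap \<open>\<beta>\<close>.
\<close>

lemma flat_alphabet_has_gap:
  assumes M: "M \<ge> 3" "1 < A" "A < M" and \<sigma>: "\<sigma> = real M powr (2 * \<epsilon>)" "\<sigma> \<ge> 2"
    and S: "S \<in> flat_alphabets M A (sqrt (real A) * \<sigma> / 2)" and chi: "cutoff chi"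
  shows "has_spectral_gap M S chi (1/2 - 3/4 * (ln (real A) / ln (real M)) - \<epsilon>)"
proof -
  define \<beta> where "\<beta> = 1/2 - 3/4 * (ln (real A) / ln (real M)) - \<epsilon>"
  define a where "a = sqrt (real A)"
  have a: "a \<ge> 1" "a * a = real A" using M by (simp_all add: a_def)
  have sub: "S \<subseteq> {..<M}" "card S = A" using S by (auto simp: flat_alphabets_def alphabets_def)
  have ne: "S \<noteq> {}" using sub(2) M(2) by auto
  have "fourier_bound M S S (real (card S) + (real (card S) - 1) * (a * \<sigma> / 2))"
    using S \<sigma> a by (intro fourier_bound_alphabet sub ne) (auto simp: flat_alphabets_def a_def)
  moreover have "real (card S) + (real (card S) - 1) * (a * \<sigma> / 2) \<le> real M powr (1 - 2 * \<beta>)"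
  proof -
    have "real A + (real A - 1) * (a * \<sigma> / 2) \<le> real A + real A * (a * \<sigma> / 2)"
      using a \<sigma> by (intro add_left_mono mult_right_mono) auto
    \<comment> \<open>The diagonal contribution \<open>A\<close> is absorbed because \<open>a * \<sigma> \<ge> 2\<close>.\<close>
    also have "\<dots> \<le> real A * (a * \<sigma>)"
    proof -
      have "1 * 2 \<le> a * \<sigma>" using a \<sigma> by (intro mult_mono) auto
      hence "real A * 1 \<le> real A * (a * \<sigma> / 2)" by (intro mult_left_mono) auto
      thus ?thesis by simp
    qed
    also have "real A * (a * \<sigma>) = real A powr (3/2) * \<sigma>"
    proof -
      have "real A powr (3/2) = real A powr (1 + 1/2)" by simp
      also have "\<dots> = real A * a" unfolding powr_add a_def using M by (simp add: powr_half_sqrt)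
      finally show ?thesis by simp
    qed
    also have "real A powr (3/2) = real M powr (3/2 * (ln (real A) / ln (real M)))"
      using M by (simp add: powr_def)
    also have "real M powr (3/2 * (ln (real A) / ln (real M))) * \<sigma> = real M powr (1 - 2 * \<beta>)"
      unfolding \<sigma>(1) powr_add[symmetric] \<beta>_def by (rule arg_cong[where f = "\<lambda>t. real M powr t"]) simp
    finally show ?thesis by (simp add: sub(2))
  qed
  ultimately have "fourier_bound M S S (real M powr (1 - 2 * \<beta>))" by (rule fourier_bound_mono)
  thus ?thesis unfolding \<beta>_def using chi M sub ne
    by (intro has_spectral_gap_if_fourier_bound) auto
qed

lemma most_alphabets_have_gap:
  fixes \<epsilon> :: real
  assumes M: "M \<ge> 3" "1 < A" "A < M" and "\<epsilon> > 0"
  obtains G where "G \<subseteq> alphabets M A"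
    "measure (alphabet_measure M A) (alphabets M A - G) \<le> 4 * real M * exp (- (real M powr (4 * \<epsilon>)) / 64)"
    "\<And>S chi. S \<in> G \<Longrightarrow> cutoff chi \<Longrightarrow> has_spectral_gap M S chi (1/2 - 3/4 * (ln (real A) / ln (real M)) - \<epsilon>)"
proof -
  define \<sigma> where "\<sigma> = real M powr (2 * \<epsilon>)"
  have \<sigma>0: "\<sigma> \<ge> 0" by (simp add: \<sigma>_def)
  have sq: "\<sigma>\<^sup>2 = real M powr (4 * \<epsilon>)"
    by (simp add: \<sigma>_def power2_eq_square flip: powr_add)
  have choose: "M choose A > 0" using M by simp
  show ?thesis
  proof (cases "\<sigma> \<ge> 2")
    case True
    have "measure (alphabet_measure M A) (alphabets M A - flat_alphabets M A (sqrt (real A) * \<sigma> / 2))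
        \<le> 4 * real M * exp (- ((sqrt (real A) * \<sigma> / 2)\<^sup>2 / (8 * real A)))"
      using M \<sigma>0 by (intro measure_not_flat) auto
    also have "(sqrt (real A) * \<sigma> / 2)\<^sup>2 / (8 * real A) = \<sigma>\<^sup>2 / 32"
      using M by (simp add: power_mult_distrib power_divide)
    also have "4 * real M * exp (- (\<sigma>\<^sup>2 / 32)) \<le> 4 * real M * exp (- (\<sigma>\<^sup>2) / 64)"
      by (intro mult_left_mono) auto
    finally show ?thesis
      using flat_alphabet_has_gap[OF M \<sigma>_def True]
      by (intro that[of "flat_alphabets M A (sqrt (real A) * \<sigma> / 2)"]) (auto simp: sq flat_alphabets_def)
  next
    case False
    \<comment> \<open>Here the allowed measure exceeds one, so no alphabet needs to be good.\<close>
    hence "\<sigma>\<^sup>2 \<le> 2\<^sup>2" using \<sigma>0 by (intro power_mono) auto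
    hence "1 / 12 \<le> 1 + - (\<sigma>\<^sup>2) / 64" by simp
    also have "\<dots> \<le> exp (- (\<sigma>\<^sup>2) / 64)" by (rule exp_ge_add_one_self)
    finally have "12 * (1 / 12) \<le> 4 * real M * exp (- (\<sigma>\<^sup>2) / 64)"
      using M by (intro mult_mono) auto
    moreover have "measure (alphabet_measure M A) (alphabets M A - {}) = 1"
      using choose by (subst measure_alphabet_measure) (auto simp: card_alphabets)
    ultimately show ?thesis by (intro that[of "{}"]) (auto simp: sq)
  qed
qed

lemma expected_spectral_gap_ge:
  assumes "G \<subseteq> alphabets M A" "A \<le> M" "\<beta> \<ge> 0" "\<And>S. S \<in> G \<Longrightarrow> has_spectral_gap M S chi \<beta>"
    and "measure (alphabet_measure M A) (alphabets M A - G) \<le> \<eta>"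
  shows "(\<integral>\<^sup>+ S. spectral_gap M S chi \<partial>alphabet_measure M A) \<ge> ennreal (\<beta> * (1 - \<eta>))"
proof -
  have choose: "real (M choose A) > 0" using assms(2) by simp
  have sets: "sets (alphabet_measure M A) = Pow (alphabets M A)"
    by (simp add: alphabet_measure_def sets_uniform_count_measure)
  have "alphabets M A \<noteq> {}" using choose card_alphabets[of M A] by (metis card.empty of_nat_0 less_irrefl)
  then interpret prob_space "alphabet_measure M A"
    unfolding alphabet_measure_def by (intro prob_space_uniform_count_measure) auto
  have "prob (alphabets M A - G) = 1 - prob G"
    using prob_compl[of G] sets assms(1) by (simp add: alphabet_measure_def space_uniform_count_measure)
  hence "\<beta> * (1 - \<eta>) \<le> \<beta> * prob G" using assms(3,5) by (intro mult_left_mono) auto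
  hence "ennreal (\<beta> * (1 - \<eta>)) \<le> ennreal \<beta> * emeasure (alphabet_measure M A) G"
    using assms(3) by (simp add: emeasure_eq_measure ennreal_leI flip: ennreal_mult)
  also have "\<dots> = (\<integral>\<^sup>+ S. ennreal \<beta> * indicator G S \<partial>alphabet_measure M A)"
    using sets assms(1) by (simp add: nn_integral_cmult_indicator)
  also have "\<dots> \<le> (\<integral>\<^sup>+ S. spectral_gap M S chi \<partial>alphabet_measure M A)"
  proof (rule nn_integral_mono)
    fix S
    show "ennreal \<beta> * indicator G S \<le> spectral_gap M S chi"
      using assms(3,4) by (cases "S \<in> G") (auto simp: spectral_gap_def intro!: SUP_upper)
  qed
  finally show ?thesis .
qed

text \<open>
  The first term is the \<open>\<epsilon>\<close> with \<open>M\<^bsup>4\<epsilon>\<^esup> = 128 ln M\<close>, for which the exceptional alphabets have measure at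
  most \<open>4/M\<close>. The second term is what they can take away from the expectation, since the gap
  guaranteed on the others is at most \<open>1/2\<close>.
\<close>

definition gap_defect :: "nat \<Rightarrow> real" where
  "gap_defect M = ln (128 * ln (real M)) / (4 * ln (real M)) + 2 / real M"

lemma gap_defect_tendsto_0: "gap_defect \<longlonglongrightarrow> 0"
  unfolding gap_defect_def by real_asymp

lemma expected_spectral_gap_lower_bound:
  assumes M: "M \<ge> 3" "1 < A" "A < M" and chi: "cutoff chi"
  shows "(\<integral>\<^sup>+ S. spectral_gap M S chi \<partial>alphabet_measure M A) \<ge>
    ennreal (max 0 (1/2 - 3/4 * (ln (real A) / ln (real M)) - gap_defect M))"
proof (cases "1/2 - 3/4 * (ln (real A) / ln (real M)) - gap_defect M \<le> 0")
  case True
  thus ?thesis by (simp add: max_def)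
next
  case False
  define \<epsilon> where "\<epsilon> = ln (128 * ln (real M)) / (4 * ln (real M))"
  define \<beta> where "\<beta> = 1/2 - 3/4 * (ln (real A) / ln (real M)) - \<epsilon>"
  have "exp 1 \<le> real M" using M(1) exp_le by linarith
  hence lnM: "ln (real M) \<ge> 1" using M by (subst ln_ge_iff) auto
  hence \<epsilon>: "\<epsilon> > 0" by (simp add: \<epsilon>_def)
  have "real M powr (4 * \<epsilon>) = 128 * ln (real M)"
    using M lnM by (simp add: \<epsilon>_def powr_def)
  hence "exp (- (real M powr (4 * \<epsilon>)) / 64) = 1 / (real M * real M)"
    using M by (simp add: exp_minus exp_double power2_eq_square inverse_eq_divide)
  hence bad: "4 * real M * exp (- (real M powr (4 * \<epsilon>)) / 64) = 4 / real M"
    using M by simp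
  obtain G where G: "G \<subseteq> alphabets M A"
    "measure (alphabet_measure M A) (alphabets M A - G) \<le> 4 / real M"
    "\<And>S chi. S \<in> G \<Longrightarrow> cutoff chi \<Longrightarrow> has_spectral_gap M S chi \<beta>"
    using most_alphabets_have_gap[OF M \<epsilon>] unfolding bad \<beta>_def by metis
  have \<beta>: "\<beta> - 2 / real M > 0" using False by (simp add: \<beta>_def \<epsilon>_def gap_defect_def)
  have "2 / real M > 0" using M by simp
  hence \<beta>0: "\<beta> \<ge> 0" using \<beta> by linarith
  have "ln (real A) / ln (real M) \<ge> 0" using M lnM by simp
  hence "\<beta> \<le> 1 / 2" using \<epsilon> by (simp add: \<beta>_def)
  hence "\<beta> * (4 / real M) \<le> 1 / 2 * (4 / real M)" by (intro mult_right_mono) auto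
  hence "\<beta> - 2 / real M \<le> \<beta> * (1 - 4 / real M)" by (simp add: right_diff_distrib)
  hence "ennreal (\<beta> - 2 / real M) \<le> ennreal (\<beta> * (1 - 4 / real M))" by (rule ennreal_leI)
  also have "\<dots> \<le> (\<integral>\<^sup>+ S. spectral_gap M S chi \<partial>alphabet_measure M A)"
    using M G chi by (intro expected_spectral_gap_ge[OF G(1) _ \<beta>0]) auto
  finally show ?thesis using \<beta> by (simp add: \<beta>_def \<epsilon>_def gap_defect_def max_def algebra_simps)
qed

theorem corollary1p5:
  shows
    "(\<forall>(M::nat) (A::nat) (\<delta>::real) (\<epsilon>::real).
        M \<ge> 3 \<and> 1 < A \<and> A < M \<and> \<delta> = ln (real A) / ln (real M) \<and>
        \<delta> \<in> {0<..<2/3} \<and> \<epsilon> > 0 \<longrightarrow>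
        (\<exists>G. G \<subseteq> alphabets M A \<and>
             measure (alphabet_measure M A) (alphabets M A - G)
               \<le> 4 * real M * exp (- (real M powr (4 * \<epsilon>)) / 64) \<and>
             (\<forall>S\<in>G. \<forall>chi. cutoff chi \<longrightarrow>
                has_spectral_gap M S chi (1/2 - 3/4 * \<delta> - \<epsilon>))))
     \<and>
     (\<exists>\<omega> :: nat \<Rightarrow> real. \<omega> \<longlonglongrightarrow> 0 \<and>
        (\<forall>(M::nat) (A::nat) (\<delta>::real) (chi :: real \<Rightarrow> real).
           M \<ge> 3 \<and> 1 < A \<and> A < M \<and> \<delta> = ln (real A) / ln (real M) \<and>
           \<delta> \<in> {0<..<1} \<and> cutoff chi \<longrightarrow>
           (\<integral>\<^sup>+ S. spectral_gap M S chi \<partial>alphabet_measure M A)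
             \<ge> ennreal (max 0 (1/2 - 3/4 * \<delta> + \<omega> M))))"
proof (intro conjI allI impI)
  fix M A :: nat and \<delta> \<epsilon> :: real
  assume *: "M \<ge> 3 \<and> 1 < A \<and> A < M \<and> \<delta> = ln (real A) / ln (real M) \<and> \<delta> \<in> {0<..<2/3} \<and> \<epsilon> > 0"
  hence M: "M \<ge> 3" "1 < A" "A < M" "\<epsilon> > 0" and \<delta>: "\<delta> = ln (real A) / ln (real M)" by blast+
  show "\<exists>G. G \<subseteq> alphabets M A \<and>
             measure (alphabet_measure M A) (alphabets M A - G)
               \<le> 4 * real M * exp (- (real M powr (4 * \<epsilon>)) / 64) \<and>
             (\<forall>S\<in>G. \<forall>chi. cutoff chi \<longrightarrow> has_spectral_gap M S chi (1/2 - 3/4 * \<delta> - \<epsilon>))"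
    using most_alphabets_have_gap[OF M] unfolding \<delta> by metis
next
  have "(\<lambda>M. - gap_defect M) \<longlonglongrightarrow> 0"
    using tendsto_minus[OF gap_defect_tendsto_0] by simp
  thus "\<exists>\<omega> :: nat \<Rightarrow> real. \<omega> \<longlonglongrightarrow> 0 \<and>
        (\<forall>(M::nat) (A::nat) (\<delta>::real) (chi :: real \<Rightarrow> real).
           M \<ge> 3 \<and> 1 < A \<and> A < M \<and> \<delta> = ln (real A) / ln (real M) \<and>
           \<delta> \<in> {0<..<1} \<and> cutoff chi \<longrightarrow>
           (\<integral>\<^sup>+ S. spectral_gap M S chi \<partial>alphabet_measure M A)
             \<ge> ennreal (max 0 (1/2 - 3/4 * \<delta> + \<omega> M)))"
    using expected_spectral_gap_lower_bound by (intro exI[of _ "\<lambda>M. - gap_defect M"]) auto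
qed

end
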